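(* Let $\lambda>0$ and $c\ge 2.57$. There is an FPTAS for ${\rm Holant}(\mathcal{F}_{c}^{c/2,\,c+2/c},\Lambda_{\lambda,+\infty})$.
   Context: A weighted Holant instance is $\Omega=(G(V,E),\{F_v\}_{v\in V},\{\lambda_e\}_{e\in E})$, where $G(V,E)$ is a graph, $F_v:\{0,1\}^{d_v}\to\mathbb{R}_{\ge 0}$ with $d_v$ the degree of $v$, and $\lambda_e\ge 0$ is the weight of edge $e$. Its partition function is $$Z(\Omega)=\sum_{\sigma:E\to\{0,1\}}\ \prod_{e\in E}\lambda_e^{\sigma(e)}\prod_{v\in V}F_v(\sigma|_{E(v)}),$$ where $E(v)$ is the set of edges incident to $v$. ${\rm Holant}(\mathcal{F},\Lambda)$ is the problem of computing $Z(\Omega)$, given an instance $\Omega$ with all $F_v\in\mathcal{F}$ and all $\lambda_e\in\Lambda$. A symmetric function of arity $d$ is written $[f_0,f_1,\dots,f_d]$, with $f_i\ge 0$ its value on inputs of Hamming weight $i$. $\mathcal{F}_c$ is the set of (generalized) Fibonacci functions with parameter $c$, i.e. symmetric functions with $f_{i+2}=c f_{i+1}+f_i$ for $i=0,\dots,d-2$. $\mathcal{F}_c^{p,q}$ is the set of functions in $\mathcal{F}_c$ (of any arity) with $p f_i\le f_{i+1}\le q f_i$ for all $i=0,\dots,d-1$. $\Lambda_{\lambda,+\infty}$ is the set of edge weights $\lambda_e\ge\lambda$. An FPTAS is a deterministic algorithm which, given an instance of size $n$ and $\varepsilon>0$, outputs $Z'$ with $(1-\varepsilon)Z<Z'<(1+\varepsilon)Z$,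 where $Z$ is the correct value, in time polynomial in $n$ and $1/\varepsilon$.
   Formalization: Zero functions lie in the family, so Z=0 occurs and the strict bounds (1-ε)Z<Z'<(1+ε)Z cannot hold; for Z=0 the output is required to be exactly 0. Time is counted as steps of exact real arithmetic, with n=|V|+|E|. *)

theory Defs
  imports Complex_Main "HOL-Library.FuncSet"
begin

section \<open>Holant instances\<close>

text \<open>
  A constraint function \<open>{0,1}\<^sup>d \<rightarrow> \<real>\<close> is represented by its arity together with a function on
  Boolean lists, of which only the values on lists of length \<open>d\<close> are ever used.
\<close>

type_synonym constraint = "nat \<times> (bool list \<Rightarrow> real)"

text \<open>
  The vertices are \<open>{..<nV}\<close> and the edges \<open>{..<nE}\<close>.  The graph is undirected: the order of the
  two components of \<open>ends e\<close> plays no role.  Parallel edges are permitted, self-loops are not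
  (so that the degree of \<open>v\<close> is the number of elements of \<open>E(v)\<close>).
\<close>

record holant_inst =
  nV :: nat
  nE :: nat
  ends :: "nat \<Rightarrow> nat \<times> nat"
  weight :: "nat \<Rightarrow> real"
  fn :: "nat \<Rightarrow> bool list \<Rightarrow> real"

definition incident :: "holant_inst \<Rightarrow> nat \<Rightarrow> nat list" where
  "incident \<Omega> v = filter (\<lambda>e. v = fst (ends \<Omega> e) \<or> v = snd (ends \<Omega> e)) [0..<nE \<Omega>]"

definition degree :: "holant_inst \<Rightarrow> nat \<Rightarrow> nat" where
  "degree \<Omega> v = length (incident \<Omega> v)"

definition wf_inst :: "holant_inst \<Rightarrow> bool" where
  "wf_inst \<Omega> \<longleftrightarrow>
     (\<forall>e<nE \<Omega>. fst (ends \<Omega> e) < nV \<Omega> \<and> snd (ends \<Omega> e) < nV \<Omega> \<and>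
        fst (ends \<Omega> e) \<noteq> snd (ends \<Omega> e)) \<and>
     (\<forall>e<nE \<Omega>. 0 \<le> weight \<Omega> e) \<and>
     (\<forall>v<nV \<Omega>. \<forall>x. length x = degree \<Omega> v \<longrightarrow> 0 \<le> fn \<Omega> v x)"

definition partition_function :: "holant_inst \<Rightarrow> real" where
  "partition_function \<Omega> =
     (\<Sum>\<sigma> \<in> {..<nE \<Omega>} \<rightarrow>\<^sub>E (UNIV :: bool set).
        (\<Prod>e<nE \<Omega>. weight \<Omega> e ^ of_bool (\<sigma> e)) *
        (\<Prod>v<nV \<Omega>. fn \<Omega> v (map \<sigma> (incident \<Omega> v))))"

definition Holant :: "constraint set \<Rightarrow> real set \<Rightarrow> holant_inst set" where
  "Holant \<F> \<Lambda> = {\<Omega>. wf_inst \<Omega> \<and>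
     (\<forall>v<nV \<Omega>. (degree \<Omega> v, fn \<Omega> v) \<in> \<F>) \<and> (\<forall>e<nE \<Omega>. weight \<Omega> e \<in> \<Lambda>)}"

definition inst_size :: "holant_inst \<Rightarrow> nat" where
  "inst_size \<Omega> = nV \<Omega> + nE \<Omega>"


section \<open>Symmetric functions and Fibonacci functions\<close>

text \<open>\<open>level d F i\<close> is the value \<open>f\<^sub>i\<close> in the notation \<open>[f\<^sub>0, \<dots>, f\<^sub>d]\<close> for symmetric \<open>F\<close>.\<close>

definition level :: "nat \<Rightarrow> (bool list \<Rightarrow> real) \<Rightarrow> nat \<Rightarrow> real" where
  "level d F i = F (replicate i True @ replicate (d - i) False)"

definition symmetric_fn :: "nat \<Rightarrow> (bool list \<Rightarrow> real) \<Rightarrow> bool" where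
  "symmetric_fn d F \<longleftrightarrow> (\<forall>x. length x = d \<longrightarrow> F x = level d F (count_list x True))"

definition fibonacci :: "real \<Rightarrow> constraint set" where
  "fibonacci c = {(d, F). symmetric_fn d F \<and> (\<forall>i\<le>d. 0 \<le> level d F i) \<and>
     (\<forall>i. i + 2 \<le> d \<longrightarrow> level d F (i + 2) = c * level d F (i + 1) + level d F i)}"

definition fibonacci_range :: "real \<Rightarrow> real \<Rightarrow> real \<Rightarrow> constraint set" where
  "fibonacci_range c p q = {(d, F). (d, F) \<in> fibonacci c \<and>
     (\<forall>i<d. p * level d F i \<le> level d F (i + 1) \<and> level d F (i + 1) \<le> q * level d F i)}"


section \<open>Algorithms over the reals\<close>

text \<open>
  Constraint values and edge weights are arbitrary reals, so algorithms are understood in the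
  unit-cost model of exact real arithmetic (real RAM, Blum--Shub--Smale).  Programs are written in
  a first-order functional language: a value is a real or a pointer to an immutable pair of
  values, and a program is a list of mutually recursive function definitions, entered at number 0.
  Variables are de Bruijn indices; the body of a function sees exactly its arguments.  The only
  operations on reals are the four field operations and the test \<open><\<close> (no rounding, no
  transcendental functions), and the only literals are rational.  As a program is fixed, every
  evaluation rule is a bounded number of real-RAM steps.  Division by zero and ill-typed
  operations have no result.
\<close>

datatype val = RealV real | PairV val val

datatype arith = Plus | Minus | Times | Divide

datatype expr =
    Var nat
  | Lit rat
  | Arith arith expr expr
  | IfLess expr expr expr expr  \<comment> \<open>if \<open>e\<^sub>1 < e\<^sub>2\<close> then \<open>e\<^sub>3\<close> else \<open>e\<^sub>4\<close>\<close>
  | IfPair expr expr expr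
  | MkPair expr expr
  | First expr
  | Second expr
  | LetIn expr expr
  | Call nat "expr list"

type_synonym program = "expr list"

fun arith_defined :: "arith \<Rightarrow> real \<Rightarrow> bool" where
  "arith_defined Divide y \<longleftrightarrow> y \<noteq> 0"
| "arith_defined _ y \<longleftrightarrow> True"

fun arith_apply :: "arith \<Rightarrow> real \<Rightarrow> real \<Rightarrow> real" where
  "arith_apply Plus x y = x + y"
| "arith_apply Minus x y = x - y"
| "arith_apply Times x y = x * y"
| "arith_apply Divide x y = x / y"

text \<open>
  \<open>eval P env e v t\<close>: under the definitions \<open>P\<close> and with the variables bound to \<open>env\<close>, the
  expression \<open>e\<close> evaluates to \<open>v\<close> in \<open>t\<close> steps.
\<close>

inductive eval :: "program \<Rightarrow> val list \<Rightarrow> expr \<Rightarrow> val \<Rightarrow> nat \<Rightarrow> bool"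
  and evals :: "program \<Rightarrow> val list \<Rightarrow> expr list \<Rightarrow> val list \<Rightarrow> nat \<Rightarrow> bool"
  for P :: program where
  Var: "i < length env \<Longrightarrow> eval P env (Var i) (env ! i) 1"
| Lit: "eval P env (Lit r) (RealV (of_rat r)) 1"
| Arith: "eval P env e1 (RealV x) t1 \<Longrightarrow> eval P env e2 (RealV y) t2 \<Longrightarrow> arith_defined oper y \<Longrightarrow>
    eval P env (Arith oper e1 e2) (RealV (arith_apply oper x y)) (t1 + t2 + 1)"
| IfLess_True: "eval P env e1 (RealV x) t1 \<Longrightarrow> eval P env e2 (RealV y) t2 \<Longrightarrow> x < y \<Longrightarrow>
    eval P env e3 v t3 \<Longrightarrow> eval P env (IfLess e1 e2 e3 e4) v (t1 + t2 + t3 + 1)"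
| IfLess_False: "eval P env e1 (RealV x) t1 \<Longrightarrow> eval P env e2 (RealV y) t2 \<Longrightarrow> \<not> x < y \<Longrightarrow>
    eval P env e4 v t4 \<Longrightarrow> eval P env (IfLess e1 e2 e3 e4) v (t1 + t2 + t4 + 1)"
| IfPair_True: "eval P env e1 (PairV a b) t1 \<Longrightarrow> eval P env e2 v t2 \<Longrightarrow>
    eval P env (IfPair e1 e2 e3) v (t1 + t2 + 1)"
| IfPair_False: "eval P env e1 (RealV x) t1 \<Longrightarrow> eval P env e3 v t3 \<Longrightarrow>
    eval P env (IfPair e1 e2 e3) v (t1 + t3 + 1)"
| MkPair: "eval P env e1 a t1 \<Longrightarrow> eval P env e2 b t2 \<Longrightarrow>
    eval P env (MkPair e1 e2) (PairV a b) (t1 + t2 + 1)"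
| First: "eval P env e (PairV a b) t \<Longrightarrow> eval P env (First e) a (t + 1)"
| Second: "eval P env e (PairV a b) t \<Longrightarrow> eval P env (Second e) b (t + 1)"
| LetIn: "eval P env e1 a t1 \<Longrightarrow> eval P (a # env) e2 v t2 \<Longrightarrow>
    eval P env (LetIn e1 e2) v (t1 + t2 + 1)"
| Call: "evals P env es vs t1 \<Longrightarrow> f < length P \<Longrightarrow> eval P vs (P ! f) v t2 \<Longrightarrow>
    eval P env (Call f es) v (t1 + t2 + 1)"
| Empty: "evals P env [] [] 0"
| More: "eval P env e v t1 \<Longrightarrow> evals P env es vs t2 \<Longrightarrow>
    evals P env (e # es) (v # vs) (t1 + t2 + 1)"

inductive_cases eval_elims:
  "eval P env (Var i) v t" "eval P env (Lit r) v t" "eval P env (Arith oper e1 e2) v t"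
  "eval P env (IfLess e1 e2 e3 e4) v t" "eval P env (IfPair e1 e2 e3) v t"
  "eval P env (MkPair e1 e2) v t" "eval P env (First e) v t" "eval P env (Second e) v t"
  "eval P env (LetIn e1 e2) v t" "eval P env (Call f es) v t"
  "evals P env [] vs t" "evals P env (e # es) vs t"

lemma eval_deterministic:
  "eval P env e v t \<Longrightarrow> eval P env e v' t' \<Longrightarrow> v' = v \<and> t' = t"
  "evals P env es vs t \<Longrightarrow> evals P env es vs' t' \<Longrightarrow> vs' = vs \<and> t' = t"
proof (induction arbitrary: v' t' and vs' t' rule: eval_evals.inducts)
  case Var then show ?case by (auto elim: eval_elims(1))
next
  case Lit then show ?case by (auto elim: eval_elims(2))
next
  case Arith from Arith.prems show ?case by (rule eval_elims(3)) (auto dest!: Arith.IH(2,4))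
next
  case IfLess_True
  from IfLess_True.prems show ?case
    by (rule eval_elims(4)) (use IfLess_True.hyps in \<open>auto dest!: IfLess_True.IH(2,4,6)\<close>)+
next
  case IfLess_False
  from IfLess_False.prems show ?case
    by (rule eval_elims(4)) (use IfLess_False.hyps in \<open>auto dest!: IfLess_False.IH(2,4,6)\<close>)+
next
  case IfPair_True
  from IfPair_True.prems show ?case by (rule eval_elims(5)) (auto dest!: IfPair_True.IH(2,4))+
next
  case IfPair_False
  from IfPair_False.prems show ?case by (rule eval_elims(5)) (auto dest!: IfPair_False.IH(2,4))+
next
  case MkPair from MkPair.prems show ?case by (rule eval_elims(6)) (auto dest!: MkPair.IH(2,4))
next
  case First from First.prems show ?case by (rule eval_elims(7)) (auto dest!: First.IH(2))
next
  case Second from Second.prems show ?case by (rule eval_elims(8)) (auto dest!: Second.IH(2))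
next
  case LetIn from LetIn.prems show ?case by (rule eval_elims(9)) (auto dest!: LetIn.IH(2,4))
next
  case Call from Call.prems show ?case by (rule eval_elims(10)) (auto dest!: Call.IH(2,5))
next
  case Empty then show ?case by (auto elim: eval_elims(11))
next
  case More from More.prems show ?case by (rule eval_elims(12)) (auto dest!: More.IH(2,4))
qed

definition runs :: "program \<Rightarrow> val list \<Rightarrow> val \<Rightarrow> nat \<Rightarrow> bool" where
  "runs P args v t \<longleftrightarrow> P \<noteq> [] \<and> eval P args (P ! 0) v t"


section \<open>Fully polynomial-time approximation schemes\<close>

fun list_val :: "val list \<Rightarrow> val" where
  "list_val [] = RealV 0"
| "list_val (v # vs) = PairV v (list_val vs)"

text \<open>
  A constraint function enters the input as the list \<open>[f\<^sub>0, \<dots>, f\<^sub>d]\<close>, so this encoding is meant for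
  instances whose constraint functions are symmetric.
\<close>

definition encode_vertex :: "holant_inst \<Rightarrow> nat \<Rightarrow> val" where
  "encode_vertex \<Omega> v =
     list_val (map (\<lambda>i. RealV (level (degree \<Omega> v) (fn \<Omega> v) i)) [0..<degree \<Omega> v + 1])"

definition encode_edge :: "holant_inst \<Rightarrow> nat \<Rightarrow> val" where
  "encode_edge \<Omega> e =
     PairV (PairV (RealV (real (fst (ends \<Omega> e)))) (RealV (real (snd (ends \<Omega> e)))))
       (RealV (weight \<Omega> e))"

definition encode :: "holant_inst \<Rightarrow> val" where
  "encode \<Omega> = PairV (list_val (map (encode_vertex \<Omega>) [0..<nV \<Omega>]))
     (list_val (map (encode_edge \<Omega>) [0..<nE \<Omega>]))"

text \<open>
  The strict bounds \<open>(1 - \<epsilon>) Z < Z' < (1 + \<epsilon>) Z\<close> cannot be met when \<open>Z = 0\<close>, which does occur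
  for the families above because they contain the zero functions; there the exact value
  is required.
\<close>

definition approximates :: "real \<Rightarrow> real \<Rightarrow> real \<Rightarrow> bool" where
  "approximates \<epsilon> Z Z' \<longleftrightarrow>
     (if Z = 0 then Z' = 0 else (1 - \<epsilon>) * Z < Z' \<and> Z' < (1 + \<epsilon>) * Z)"

text \<open>
  \<open>ps\<close> lists the real parameters of the problem, which are fixed and which the algorithm
  may use as constants.  A function of \<open>n\<close> and \<open>1/\<epsilon>\<close> is polynomially bounded iff it is bounded by
  some \<open>C (1 + n + 1/\<epsilon>)\<^sup>k\<close>.
\<close>

definition has_FPTAS :: "real list \<Rightarrow> constraint set \<Rightarrow> real set \<Rightarrow> bool" where
  "has_FPTAS ps \<F> \<Lambda> \<longleftrightarrow>
     (\<exists>P C k. \<forall>\<Omega> \<in> Holant \<F> \<Lambda>. \<forall>\<epsilon>>0. \<exists>Z' t.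
        runs P (map RealV ps @ [encode \<Omega>, RealV \<epsilon>]) (RealV Z') t \<and>
        approximates \<epsilon> (partition_function \<Omega>) Z' \<and>
        real t \<le> C * (1 + real (inst_size \<Omega>) + 1 / \<epsilon>) ^ k)"

end

theory Submission
  imports Defs
begin

text \<open>
  For a vertex \<open>v\<close> let \<open>R\<^sub>v\<close> be the ratio of the partition functions obtained by attaching to \<open>v\<close> a
  half-edge pinned to \<open>1\<close> and to \<open>0\<close>.  Peeling off the edges one at a time writes \<open>Z\<close> as
  \<open>\<Prod>\<^sub>v f\<^sub>v(0) \<cdot> \<Prod>\<^sub>e (1 + \<lambda>\<^sub>e R R')\<close>.  Removing one edge \<open>vu\<close> expresses \<open>R\<^sub>v\<close> through three such ratios in
  the smaller graph: \<open>R\<^sub>v\<close> with the half-edge at \<open>u\<close> pinned to \<open>0\<close> or \<open>1\<close>, and \<open>R\<^sub>u\<close> with \<open>v\<close> pinned.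
  Pinning keeps all vertex ratios inside the interval from \<open>c/2\<close> to \<open>c + 2/c\<close>.  In the metric
  \<open>ln ((1 + S) / (3/2 - S))\<close> of the coordinate \<open>S = (\<alpha> - R) / (R + 1/\<alpha>)\<close>, with \<open>\<alpha>\<close> the positive root
  of \<open>x\<^sup>2 = c x + 1\<close>, this step contracts by a factor that depends only on \<open>\<lambda>\<close>.  So truncating the
  recursion at logarithmic depth is accurate enough, and there are three calls per level whatever the
  degrees are.
\<close>

section \<open>Contraction of the recursion step\<close>

text \<open>The vertex \<open>v\<close> stays in play after one of its edges is removed, and the
  argument \<open>S0\<close> at the same vertex enters with a weight \<open>p\<close> that is close
  to 1 when the edge is rarely used. So depth has to count removed edges rather than distance. The
  gain per edge is of order 1 - p, which is bounded away from 0 because every edge weight is at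
  least \<lambda>; large degrees and large weights then do no harm. The weight (1 + S)(3/2 - S) is
  fitted to this step. Its factor 1 + S cancels the pole at S = -1 in the logarithmic derivative of
  the edge odds with respect to \<open>Su\<close>, and both of its zeros lie outside the interval
  from -b to 1, so that this interval has finite diameter. The condition c \<ge> 2.57 enters through
  b \<le> 3/25, at which two of the estimates in \<open>key_inequality\<close> are tight. Logarithms
  occur in the analysis alone: the program computes with the ratios themselves and finds its depth
  by repeated multiplication.\<close>

definition pot_weight :: "real \<Rightarrow> real" where "pot_weight S = (1 + S) * (3/2 - S)"
definition pot :: "real \<Rightarrow> real" where "pot S = ln (1 + S) - ln (3/2 - S)"
definition unpot :: "real \<Rightarrow> real" where "unpot \<tau> = (3/2 * exp \<tau> - 1) / (1 + exp \<tau>)"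

lemma unpot_pot:
  assumes "-1 < S" "S < 3/2"
  shows "unpot (pot S) = S"
proof -
  have e: "exp (pot S) = (1 + S) / (3/2 - S)"
    using assms by (simp add: pot_def exp_diff)
  have "1 + (1 + S) / (3/2 - S) = (5/2) / (3/2 - S)"
    using assms by (simp add: field_simps)
  moreover have "3/2 * ((1 + S) / (3/2 - S)) - 1 = (5/2 * S) / (3/2 - S)"
    using assms by (simp add: field_simps)
  ultimately show ?thesis unfolding unpot_def e using assms by simp
qed

lemma unpot_alt: "unpot \<tau> = 3/2 - (5/2) / (1 + exp \<tau>)"
proof -
  have "1 + exp \<tau> \<noteq> 0" by (smt (verit) exp_gt_zero)
  then show ?thesis unfolding unpot_def by (simp add: field_simps)
qed

lemma unpot_mono: "\<sigma> \<le> \<tau> \<Longrightarrow> unpot \<sigma> \<le> unpot \<tau>"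
  unfolding unpot_alt by (simp add: divide_left_mono add_pos_pos)

lemma pot_mono: "-1 < S \<Longrightarrow> S \<le> T \<Longrightarrow> T < 3/2 \<Longrightarrow> pot S \<le> pot T"
  unfolding pot_def by (intro diff_mono) auto

lemma unpot_deriv: "(unpot has_real_derivative pot_weight (unpot \<tau>) * (2/5)) (at \<tau>)"
proof -
  define k where "k = 1 + exp \<tau>"
  have k: "k > 0" unfolding k_def by (simp add: add_pos_pos)
  have ek: "exp \<tau> = k - 1" by (simp add: k_def)
  have "((\<lambda>\<tau>. 3/2 - (5/2) / (1 + exp \<tau>)) has_real_derivative
      5/2 * exp \<tau> / (1 + exp \<tau>)^2) (at \<tau>)"
    by (rule derivative_eq_intros refl)+
      (use k in \<open>auto simp: k_def power2_eq_square\<close>)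
  moreover have "5/2 * exp \<tau> / (1 + exp \<tau>)^2 = pot_weight (unpot \<tau>) * (2/5)"
    unfolding pot_weight_def unpot_alt k_def[symmetric] ek using k
    by (simp add: field_simps power2_eq_square)
  ultimately show ?thesis unfolding unpot_alt[abs_def] by metis
qed

lemma pot_deriv:
  assumes "-1 < S" "S < 3/2"
  shows "(pot has_real_derivative (5/2) / pot_weight S) (at S)"
proof -
  have "(pot has_real_derivative 1 / (1 + S) + 1 / (3/2 - S)) (at S)"
    unfolding pot_def[abs_def] using assms
    by (auto intro!: derivative_eq_intros)
  moreover have "1 / (1 + S) + 1 / (3/2 - S) = (5/2) / pot_weight S"
    unfolding pot_weight_def using assms by (simp add: field_simps)
  ultimately show ?thesis by simp
qed

text \<open>
  If \<open>\<alpha>\<close> is the positive root of \<open>x\<^sup>2 = c x + 1\<close> and \<open>b = 1/\<alpha>\<^sup>2\<close>, every solution of the Fibonacci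
  recurrence is a multiple of \<open>\<alpha>\<^sup>i (1 + (-b)\<^sup>i S)\<close>, so its initial ratio is \<open>\<alpha> (1 - b S) / (1 + S)\<close>.  In the
  coordinate \<open>S\<close> the interval from \<open>c/2\<close> to \<open>c + 2/c\<close> becomes \<open>-b \<le> S \<le> 1\<close>, and \<open>spin_step\<close> is the step
  \<open>combine\<close> below, with \<open>S0\<close>, \<open>S1\<close>, \<open>Su\<close> the coordinates of its three arguments.
\<close>
definition edge_odds :: "real \<Rightarrow> real \<Rightarrow> real \<Rightarrow> real \<Rightarrow> real \<Rightarrow> real" where
  "edge_odds b l S0 S1 Su = l / b * ((1 - b * Su) / (1 + Su)) * ((1 + b^2 * S0) / (1 + b^2 * S1))"
definition spin_step :: "real \<Rightarrow> real \<Rightarrow> real \<Rightarrow> real \<Rightarrow> real \<Rightarrow> real" where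
  "spin_step b l S0 S1 Su = (S0 - b * edge_odds b l S0 S1 Su * S1) / (1 + edge_odds b l S0 S1 Su)"

lemma pot_weight_le: "pot_weight S \<le> 8/5"
proof -
  have "(S - 1/4)^2 \<ge> 0" by simp
  then show ?thesis unfolding pot_weight_def by (simp add: power2_eq_square algebra_simps)
qed

lemma pot_weight_nonneg: "-1 \<le> S \<Longrightarrow> S \<le> 1 \<Longrightarrow> 0 \<le> pot_weight S"
  unfolding pot_weight_def by simp

lemma pot_weight_convex_comb:
  "pot_weight (p * S + (1 - p) * T) = p * pot_weight S + (1 - p) * pot_weight T + p * (1 - p) * (S - T)^2"
  unfolding pot_weight_def by algebra

text \<open>
  Bounds the logarithmic gradient of \<open>spin_step\<close>, where \<open>p = 1 / (1 + edge_odds)\<close>.  The gain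
  \<open>p (1 - p) (S0 - T)\<^sup>2\<close> comes from the concavity of \<open>pot_weight\<close>; this is why a quadratic weight is used.
\<close>
lemma key_inequality:
  assumes b: "0 < b" "b \<le> 3/25" and p: "0 \<le> p" "p \<le> 1"
    and S0: "-b \<le> S0" "S0 \<le> 1" and S1: "-b \<le> S1" "S1 \<le> 1" and Su: "-b \<le> Su" "Su \<le> 1"
  defines "T \<equiv> - b * S1"
  defines "D \<equiv> \<bar>S0 - T\<bar>"
  shows "(p + p * (1 - p) * D * (b^2 / (1 + b^2 * S0))) * pot_weight S0
     + (1 - p) * (b + p * D * (b^2 / (1 + b^2 * S1))) * pot_weight S1
     + p * (1 - p) * D * ((1 + b) / ((1 + Su) * (1 - b * Su))) * pot_weight Su
     \<le> pot_weight (p * S0 + (1 - p) * T) - 17/50 * (1 - p)"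
proof -
  have b2: "b^2 \<le> 9/625" using power_mono[of b "3/25" 2] b by (simp add: power2_eq_square)
  have aux: "b^2 / (1 + b^2 * S) * pot_weight S \<le> 1/40" if "-b \<le> S" "S \<le> 1" for S
  proof -
    have "b^2 * S \<ge> b^2 * (-1)" using that b by (intro mult_left_mono) auto
    then have pos: "1 + b^2 * S \<ge> 616/625" using b2 by simp
    have "b^2 * pot_weight S \<le> 9/625 * (8/5)" using b2 pot_weight_le[of S] pot_weight_nonneg[of S] that b
      by (intro mult_mono) auto
    also have "\<dots> \<le> 1/40 * (1 + b^2 * S)" using pos by simp
    finally show ?thesis using pos by (simp add: divide_le_eq)
  qed
  \<comment> \<open>The factor \<open>1 + Su\<close> of \<open>pot_weight\<close> cancels the pole
    of the coefficient. What remains is 5/2 * b \<le> 3/10, an equality at b = 3/25.\<close>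
  have u: "(1 + b) / ((1 + Su) * (1 - b * Su)) * pot_weight Su \<le> 9/5"
  proof -
    have "b * Su \<le> b * 1" using Su b by (intro mult_left_mono) auto
    then have bs: "1 - b * Su > 0" using b by linarith
    have "(1 + b) * (3/2 - Su) - 9/5 * (1 - b * Su)
        = (3/2 + 3/2*b - 9/5) - Su * (1 + b - 9/5 * b)" by algebra
    also have "\<dots> \<le> (3/2 + 3/2*b - 9/5) + b * (1 + b - 9/5 * b)"
      using mult_right_mono[of "-b" Su "1 + b - 9/5*b"] Su b by simp
    also have "\<dots> \<le> 0"
    proof -
      have "b * (1 + b - 9/5 * b) \<le> b" using b by (intro mult_left_le) auto
      then show ?thesis using b by linarith
    qed
    finally have "(1 + b) * (3/2 - Su) \<le> 9/5 * (1 - b * Su)" by simp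
    moreover have "(1 + b) / ((1 + Su) * (1 - b * Su)) * pot_weight Su = (1 + b) * (3/2 - Su) / (1 - b * Su)"
      unfolding pot_weight_def using Su b bs by simp
    ultimately show ?thesis using bs by (simp add: divide_le_eq)
  qed
  have D0: "D \<ge> 0" unfolding D_def by simp
  have D2: "D^2 = (S0 - T)^2" unfolding D_def by simp
  have pp: "p * (1 - p) * D \<ge> 0" using p D0 by simp
  \<comment> \<open>The worst case is 3/2 * (1 - b) - b, which equals 6/5 at b = 3/25.\<close>
  have sT: "pot_weight T - b * pot_weight S1 \<ge> 6/5"
  proof -
    have "pot_weight T - b * pot_weight S1 = 3/2 * (1 - b) - b * S1 + b * (1 - b) * S1^2"
      unfolding pot_weight_def T_def by algebra
    moreover have "b * (1 - b) * S1^2 \<ge> 0" using b by simp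
    moreover have "b * S1 \<le> b" using mult_left_mono[of S1 1 b] S1 b by simp
    ultimately show ?thesis using b by argo
  qed
  \<comment> \<open>Here 37/20 = 9/5 + 1/40 + 1/40 adds up \<open>u\<close> and the two uses of
    \<open>aux\<close>. The minimum is at D = 37/40, and the slack that survives below is 6/5 -
    43/50 = 17/50.\<close>
  have quad: "D^2 - 37/20 * D \<ge> - 43/50"
  proof -
    have "(D - 37/40)^2 \<ge> 0" by simp
    then show ?thesis by (simp add: power2_eq_square algebra_simps)
  qed
  have "p * (D^2 - 37/20 * D) \<ge> p * (-43/50)" using quad p by (intro mult_left_mono) auto
  then have "pot_weight T - b * pot_weight S1 + p * (D^2 - 37/20 * D) \<ge> 17/50"
    using sT p by linarith
  then have fin: "(1 - p) * (pot_weight T - b * pot_weight S1 + p * (D^2 - 37/20 * D)) \<ge> (1 - p) * (17/50)"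
    using p by (intro mult_left_mono) auto
  have "(p + p * (1 - p) * D * (b^2 / (1 + b^2 * S0))) * pot_weight S0
     + (1 - p) * (b + p * D * (b^2 / (1 + b^2 * S1))) * pot_weight S1
     + p * (1 - p) * D * ((1 + b) / ((1 + Su) * (1 - b * Su))) * pot_weight Su
     = p * pot_weight S0 + (1 - p) * b * pot_weight S1 + p * (1 - p) * D * (b^2 / (1 + b^2 * S0) * pot_weight S0
       + b^2 / (1 + b^2 * S1) * pot_weight S1 + (1 + b) / ((1 + Su) * (1 - b * Su)) * pot_weight Su)"
    by (simp add: algebra_simps)
  also have "\<dots> \<le> p * pot_weight S0 + (1 - p) * b * pot_weight S1 + p * (1 - p) * D * (37/20)"
    using aux[OF S0] aux[OF S1] u by (intro add_left_mono mult_left_mono pp) linarith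
  also have "\<dots> = pot_weight (p * S0 + (1 - p) * T) - (1 - p) * (pot_weight T - b * pot_weight S1 + p * (D^2 - 37/20 * D))"
    unfolding pot_weight_convex_comb D2[symmetric] by algebra
  finally show ?thesis using fin by linarith
qed

lemma convex_comb_range:
  fixes p b S0 S1 :: real
  assumes b: "0 < b" "b \<le> 1" and p: "0 \<le> p" "p \<le> 1"
    and S0: "-b \<le> S0" "S0 \<le> 1" and S1: "-b \<le> S1" "S1 \<le> 1"
  shows "-b \<le> p * S0 + (1 - p) * (-b * S1)" "p * S0 + (1 - p) * (-b * S1) \<le> 1"
proof -
  have l: "-b \<le> -b * S1" using mult_left_mono[of S1 1 b] b S1 by simp
  have "-b * S1 \<le> b * b" using mult_left_mono[of "-b" S1 b] b S1 by simp
  also have "b * b \<le> 1" using b mult_mono[of b 1 b 1] by simp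
  finally have u: "-b * S1 \<le> 1" .
  have "p * (-b) + (1 - p) * (-b) \<le> p * S0 + (1 - p) * (-b * S1)"
    using l p S0 by (intro add_mono mult_left_mono) auto
  then show "-b \<le> p * S0 + (1 - p) * (-b * S1)" by (simp add: algebra_simps)
  have "p * S0 + (1 - p) * (-b * S1) \<le> p * 1 + (1 - p) * 1"
    using u p S0 by (intro add_mono mult_left_mono) auto
  then show "p * S0 + (1 - p) * (-b * S1) \<le> 1" by simp
qed

text \<open>This later turns the lower bound on the edge weights into a lower bound on 1 - p. Crude
  estimates of the factors suffice, since 8 * 2/5 * 9/10 exceeds 1.\<close>

lemma edge_odds_ge:
  assumes b: "0 < b" "b \<le> 3/25" and l: "0 < l"
    and S0: "-b \<le> S0" "S0 \<le> 1" and S1: "-b \<le> S1" "S1 \<le> 1" and Su: "-b \<le> Su" "Su \<le> 1"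
  shows "edge_odds b l S0 S1 Su \<ge> l"
proof -
  have b2: "b^2 \<le> 9/625" using power_mono[of b "3/25" 2] b by (simp add: power2_eq_square)
  have 1: "b * Su \<le> b" using mult_left_mono[of Su 1 b] Su b by simp
  have 2: "b^2 * S0 \<ge> - (b^2)" using mult_left_mono[of "-1" S0 "b^2"] S0 b by simp
  have 3: "b^2 * S1 \<le> b^2" using mult_left_mono[of S1 1 "b^2"] S1 b by simp
  have 4: "b^2 * S1 \<ge> - (b^2)" using mult_left_mono[of "-1" S1 "b^2"] S1 b by simp
  have "2 * (1 + Su) \<le> 5 * (1 - b * Su)" using 1 Su b by argo
  then have x: "(1 - b * Su) / (1 + Su) \<ge> 2/5" using Su b by (simp add: pos_le_divide_eq)
  have p1: "1 + b^2 * S1 > 0" using 4 b2 by argo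
  have "9/10 * (1 + b^2 * S1) \<le> 1 + b^2 * S0" using 2 3 b2 by argo
  then have y: "(1 + b^2 * S0) / (1 + b^2 * S1) \<ge> 9/10" using p1 by (simp only: pos_le_divide_eq)
  have lb: "l / b \<ge> l * 8" using l b by (simp add: field_simps)
  have "l * 8 * (2/5) * (9/10) \<le> edge_odds b l S0 S1 Su"
    unfolding edge_odds_def
  proof (intro mult_mono lb x y mult_nonneg_nonneg)
    show "0 \<le> (1 - b * Su) / (1 + Su)" using x by linarith
  qed (use l b in auto)
  then show ?thesis using l by linarith
qed

text \<open>Without the edge, the weight of the graph with \<open>v\<close> pinned i times is A
  \<alpha>^i (1 + (-b)^i S0) if \<open>u\<close> is pinned to 0, and y B \<alpha>^i (1 + (-b)^i S1)
  if \<open>u\<close> is pinned to 1, with y the ratio at \<open>u\<close>. Using the edge adds one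
  pin at \<open>v\<close>, which replaces S1 by -b S1. The growing parts are then mixed in the
  proportion A : l y \<alpha> B, and \<open>edge_odds\<close> is the quotient of the second by the
  first.\<close>

lemma spin_step_convex:
  assumes "edge_odds b l S0 S1 Su > 0"
  defines "p \<equiv> 1 / (1 + edge_odds b l S0 S1 Su)"
  shows "spin_step b l S0 S1 Su = p * S0 + (1 - p) * (-b * S1)" "0 \<le> p" "p \<le> 1"
proof -
  let ?z = "edge_odds b l S0 S1 Su"
  have "1 - p = ?z / (1 + ?z)" using assms by (simp add: field_simps)
  then show "spin_step b l S0 S1 Su = p * S0 + (1 - p) * (-b * S1)"
    unfolding spin_step_def p_def using assms(1) by (simp add: diff_divide_distrib)
qed (use assms in auto)

lemma spin_step_range:
  assumes b: "0 < b" "b \<le> 3/25" and l: "0 < l"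
    and S0: "-b \<le> S0" "S0 \<le> 1" and S1: "-b \<le> S1" "S1 \<le> 1" and Su: "-b \<le> Su" "Su \<le> 1"
  shows "-b \<le> spin_step b l S0 S1 Su" "spin_step b l S0 S1 Su \<le> 1"
proof -
  have "edge_odds b l S0 S1 Su > 0" using edge_odds_ge[OF assms] l by simp
  note f = spin_step_convex[OF this]
  show "-b \<le> spin_step b l S0 S1 Su" "spin_step b l S0 S1 Su \<le> 1"
    using convex_comb_range[OF _ _ f(2,3) S0 S1] b f(1) by auto
qed

text \<open>Each argument moves along a path that is linear in the coordinate \<open>pot\<close>,
  and the mean value theorem is applied to the \<open>pot\<close> of the result. Monotonicity keeps
  the paths between -b and 1, and \<open>key_inequality\<close> bounds the sum of the absolute
  partial derivatives in this coordinate.\<close>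

lemma spin_step_contraction:
  assumes b: "0 < b" "b \<le> 3/25" and l: "0 < lam" "lam \<le> l"
    and S0: "-b \<le> S0" "S0 \<le> 1" and S1: "-b \<le> S1" "S1 \<le> 1" and Su: "-b \<le> Su" "Su \<le> 1"
    and X0: "-b \<le> X0" "X0 \<le> 1" and X1: "-b \<le> X1" "X1 \<le> 1" and Xu: "-b \<le> Xu" "Xu \<le> 1"
    and e: "\<bar>pot X0 - pot S0\<bar> \<le> e" "\<bar>pot X1 - pot S1\<bar> \<le> e" "\<bar>pot Xu - pot Su\<bar> \<le> e"
  shows "\<bar>pot (spin_step b l X0 X1 Xu) - pot (spin_step b l S0 S1 Su)\<bar> \<le> (1 - lam / (5 * (1 + lam))) * e"
proof -
  define path where "path S X s = unpot (pot S + s * (pot X - pot S))" for S X s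
  have path0: "path S X 0 = S" if "-b \<le> S" "S \<le> 1" for S X
    unfolding path_def using unpot_pot[of S] that b by simp
  have path1: "path S X 1 = X" if "-b \<le> X" "X \<le> 1" for S X
    unfolding path_def using unpot_pot[of X] that b by simp
  have path_deriv: "(path S X has_real_derivative (pot_weight (path S X s) * (2/5)) * (pot X - pot S)) (at s)" for S X s
  proof -
    have "((\<lambda>s. unpot (pot S + s * (pot X - pot S))) has_real_derivative
        (pot_weight (unpot (pot S + s * (pot X - pot S))) * (2/5)) * (pot X - pot S)) (at s)"
      by (rule DERIV_chain2[OF unpot_deriv]) (auto intro!: derivative_eq_intros)
    then show ?thesis unfolding path_def[abs_def] .
  qed
  have path_range: "-b \<le> path S X s \<and> path S X s \<le> 1"
    if "-b \<le> S" "S \<le> 1" "-b \<le> X" "X \<le> 1" "0 \<le> s" "s \<le> 1" for S X s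
  proof -
    have c1: "pot S + s * (pot X - pot S) = (1 - s) * pot S + s * pot X" by (simp add: algebra_simps)
    have m: "pot (-b) \<le> pot S" "pot (-b) \<le> pot X" "pot S \<le> pot 1" "pot X \<le> pot 1"
      using that b by (auto intro!: pot_mono)
    have "(1 - s) * pot (-b) + s * pot (-b) \<le> (1 - s) * pot S + s * pot X"
      using that m by (intro add_mono mult_left_mono) auto
    then have lo: "pot (-b) \<le> pot S + s * (pot X - pot S)" unfolding c1 by (simp add: algebra_simps)
    have "(1 - s) * pot S + s * pot X \<le> (1 - s) * pot 1 + s * pot 1"
      using that m by (intro add_mono mult_left_mono) auto
    then have hi: "pot S + s * (pot X - pot S) \<le> pot 1" unfolding c1 by (simp add: algebra_simps)
    show ?thesis unfolding path_def using unpot_mono[OF lo] unpot_mono[OF hi]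
        unpot_pot[of "-b"] unpot_pot[of 1] b by simp
  qed
  let ?k = "1 - lam / (5 * (1 + lam))"
  have k0: "?k \<ge> 0" using l by (simp add: field_simps)
  have e0: "e \<ge> 0" using e by linarith
  define h where "h s = pot (spin_step b l (path S0 X0 s) (path S1 X1 s) (path Su Xu s))" for s
  have "\<exists>d. (h has_real_derivative d) (at s) \<and> \<bar>d\<bar> \<le> ?k * e" if s: "0 \<le> s" "s \<le> 1" for s
  proof -
    define g0 g1 gu where "g0 = path S0 X0 s" and "g1 = path S1 X1 s" and "gu = path Su Xu s"
    have r0: "-b \<le> g0" "g0 \<le> 1" using path_range[OF S0 X0 s] by (auto simp: g0_def)
    have r1: "-b \<le> g1" "g1 \<le> 1" using path_range[OF S1 X1 s] by (auto simp: g1_def)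
    have ru: "-b \<le> gu" "gu \<le> 1" using path_range[OF Su Xu s] by (auto simp: gu_def)
    define d0 d1 du where "d0 = (pot_weight g0 * (2/5)) * (pot X0 - pot S0)"
      and "d1 = (pot_weight g1 * (2/5)) * (pot X1 - pot S1)" and "du = (pot_weight gu * (2/5)) * (pot Xu - pot Su)"
    define z where "z = edge_odds b l g0 g1 gu"
    have lpos: "0 < l" using l by simp
    have zl: "z \<ge> lam" using edge_odds_ge[OF b lpos r0 r1 ru] l unfolding z_def by simp
    then have zpos: "z > 0" using l by simp
    \<comment> \<open>Written as \<open>z\<close> times its logarithmic derivative, which produces
      the three quotients of \<open>key_inequality\<close>.\<close>
    define dz where "dz = z * ((b^2 / (1 + b^2 * g0)) * d0 - (b^2 / (1 + b^2 * g1)) * d1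
        - ((1 + b) / ((1 + gu) * (1 - b * gu))) * du)"
    have b2: "b^2 \<le> 9/625" using power_mono[of b "3/25" 2] b by (simp add: power2_eq_square)
    have nz: "1 + b^2 * g0 > 0" "1 + b^2 * g1 > 0"
      using mult_left_mono[of "-1" g0 "b^2"] mult_left_mono[of "-1" g1 "b^2"] r0 r1 b b2 by auto
    have nz': "1 - b * gu > 0" "1 + gu > 0" using mult_left_mono[of gu 1 b] ru b by linarith+
    have D0: "(path S0 X0 has_real_derivative d0) (at s)"
      unfolding d0_def g0_def by (rule path_deriv)
    have D1: "(path S1 X1 has_real_derivative d1) (at s)"
      unfolding d1_def g1_def by (rule path_deriv)
    have Du: "(path Su Xu has_real_derivative du) (at s)"
      unfolding du_def gu_def by (rule path_deriv)
    have Dz: "((\<lambda>s. edge_odds b l (path S0 X0 s) (path S1 X1 s) (path Su Xu s)) has_real_derivative dz) (at s)"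
    proof -
      have A: "((\<lambda>s. (1 - b * path Su Xu s) / (1 + path Su Xu s)) has_real_derivative
          - ((1 - b * gu) / (1 + gu)) * ((1 + b) / ((1 + gu) * (1 - b * gu))) * du) (at s)"
      proof -
        have "- ((1 - b * gu) / (1 + gu)) * ((1 + b) / ((1 + gu) * (1 - b * gu))) * du
            = - ((1 + b) * du) / ((1 + gu) * (1 + gu))"
          using nz' by simp
        also have "\<dots> = (- (b * du) * (1 + gu) - (1 - b * gu) * du) / ((1 + gu) * (1 + gu))"
          by (simp add: algebra_simps)
        finally have eq: "(- (b * du) * (1 + gu) - (1 - b * gu) * du) / ((1 + gu) * (1 + gu))
            = - ((1 - b * gu) / (1 + gu)) * ((1 + b) / ((1 + gu) * (1 - b * gu))) * du" by simp
        show ?thesis unfolding eq[symmetric]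
          by (rule derivative_eq_intros Du refl)+ (use nz' in \<open>auto simp: gu_def[symmetric]\<close>)
      qed
      have B: "((\<lambda>s. (1 + b^2 * path S0 X0 s) / (1 + b^2 * path S1 X1 s)) has_real_derivative
          ((1 + b^2 * g0) / (1 + b^2 * g1)) * ((b^2 / (1 + b^2 * g0)) * d0 - (b^2 / (1 + b^2 * g1)) * d1)) (at s)"
      proof -
        have "((1 + b^2 * g0) / (1 + b^2 * g1)) * ((b^2 / (1 + b^2 * g0)) * d0 - (b^2 / (1 + b^2 * g1)) * d1)
            = b^2 * d0 / (1 + b^2 * g1) - (1 + b^2 * g0) * (b^2 * d1) / ((1 + b^2 * g1) * (1 + b^2 * g1))"
          using nz by (simp add: right_diff_distrib)
        also have "\<dots> = ((b^2 * d0) * (1 + b^2 * g1) - (1 + b^2 * g0) * (b^2 * d1)) / ((1 + b^2 * g1) * (1 + b^2 * g1))"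
          using nz by (simp add: diff_divide_distrib)
        finally have eq: "((b^2 * d0) * (1 + b^2 * g1) - (1 + b^2 * g0) * (b^2 * d1)) / ((1 + b^2 * g1) * (1 + b^2 * g1))
            = ((1 + b^2 * g0) / (1 + b^2 * g1)) * ((b^2 / (1 + b^2 * g0)) * d0 - (b^2 / (1 + b^2 * g1)) * d1)" by simp
        show ?thesis unfolding eq[symmetric]
          by (rule derivative_eq_intros D0 D1 refl)+ (use nz in \<open>auto simp: g0_def[symmetric] g1_def[symmetric]\<close>)
      qed
      have id: "l / b * (- A1 * y * du) * B1 + (B1 * x) * (l / b * A1) = l / b * A1 * B1 * (x - y * du)"
        for A1 B1 x y by (simp add: algebra_simps diff_divide_distrib)
      show ?thesis unfolding edge_odds_def
        by (rule DERIV_cong[OF DERIV_mult[OF DERIV_cmult[OF A] B]])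
          (simp only: dz_def z_def edge_odds_def g0_def[symmetric] g1_def[symmetric] gu_def[symmetric] id)
    qed
    define p where "p = 1 / (1 + z)"
    define F where "F = spin_step b l g0 g1 gu"
    have pz: "1 - p = z / (1 + z)" unfolding p_def using zpos by (simp add: field_simps)
    have p01: "0 \<le> p" "p \<le> 1" unfolding p_def using zpos by auto
    have Fp: "F = p * g0 + (1 - p) * (-b * g1)"
      unfolding F_def p_def z_def using spin_step_convex(1)[of b l g0 g1 gu] zpos z_def by simp
    have Fr: "-b \<le> F" "F \<le> 1" using spin_step_range[OF b lpos r0 r1 ru] by (auto simp: F_def)
    \<comment> \<open>The derivative of p g0 - b (1 - p) g1, with p' = -p (1 - p) z'/z.\<close>
    define dF where "dF = p * d0 - b * (1 - p) * d1 - p * (1 - p) * (g0 + b * g1) * (dz / z)"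
    have DF: "((\<lambda>s. spin_step b l (path S0 X0 s) (path S1 X1 s) (path Su Xu s)) has_real_derivative dF) (at s)"
    proof -
      have dFz: "dF = ((d0 - b * dz * g1 - b * z * d1) * (1 + z) - (g0 - b * z * g1) * dz) / ((1 + z) * (1 + z))"
      proof -
        have "dF = d0 / (1 + z) - b * z * d1 / (1 + z) - (g0 + b * g1) * dz / ((1 + z) * (1 + z))"
          unfolding dF_def pz unfolding p_def using zpos by simp
        then show ?thesis using zpos by (simp add: divide_simps, simp add: algebra_simps)
      qed
      show ?thesis unfolding spin_step_def
        by (rule derivative_eq_intros D0 D1 Dz refl)+
          (use zpos in \<open>auto simp: g0_def[symmetric] g1_def[symmetric] gu_def[symmetric] z_def[symmetric] dFz algebra_simps\<close>)
    qed
    have Dh: "(h has_real_derivative (5/2) / pot_weight F * dF) (at s)"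
      unfolding h_def[abs_def]
      by (rule DERIV_chain2[OF _ DF]) (use pot_deriv[of F] Fr b in \<open>auto simp: F_def g0_def g1_def gu_def\<close>)
    define D where "D = \<bar>g0 - (- b * g1)\<bar>"
    have wpos: "pot_weight F > 0" unfolding pot_weight_def using Fr b by simp
    have da: "\<bar>d0\<bar> \<le> pot_weight g0 * (2/5 * e)" "\<bar>d1\<bar> \<le> pot_weight g1 * (2/5 * e)" "\<bar>du\<bar> \<le> pot_weight gu * (2/5 * e)"
      unfolding d0_def d1_def du_def
      using e pot_weight_nonneg[of g0] pot_weight_nonneg[of g1] pot_weight_nonneg[of gu] r0 r1 ru b
      by (auto simp: abs_mult intro!: mult_left_mono)
    have cpos: "0 \<le> b^2 / (1 + b^2 * g0)" "0 \<le> b^2 / (1 + b^2 * g1)"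
        "0 \<le> (1 + b) / ((1 + gu) * (1 - b * gu))" using nz nz' b by auto
    have dzz: "\<bar>dz / z\<bar> \<le> (b^2 / (1 + b^2 * g0)) * \<bar>d0\<bar> + (b^2 / (1 + b^2 * g1)) * \<bar>d1\<bar>
        + ((1 + b) / ((1 + gu) * (1 - b * gu))) * \<bar>du\<bar>"
    proof -
      have t: "\<bar>x0 * d0 - x1 * d1 - xu * du\<bar> \<le> x0 * \<bar>d0\<bar> + x1 * \<bar>d1\<bar> + xu * \<bar>du\<bar>"
        if "0 \<le> x0" "0 \<le> x1" "0 \<le> xu" for x0 x1 xu
      proof -
        have "\<bar>x0 * d0\<bar> = x0 * \<bar>d0\<bar>" "\<bar>x1 * d1\<bar> = x1 * \<bar>d1\<bar>" "\<bar>xu * du\<bar> = xu * \<bar>du\<bar>"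
          using that by (simp_all add: abs_mult)
        then show ?thesis by linarith
      qed
      show ?thesis unfolding dz_def using t[OF cpos] zpos by simp
    qed
    have regroup: "p * (w0 * f) + b * (1 - p) * (w1 * f) + p * (1 - p) * D * (x0 * (w0 * f) + x1 * (w1 * f) + xu * (wu * f))
        = ((p + p * (1 - p) * D * x0) * w0 + (1 - p) * (b + p * D * x1) * w1 + p * (1 - p) * D * xu * wu) * f"
      for w0 w1 wu x0 x1 xu f by algebra
    have "\<bar>dF\<bar> \<le> p * \<bar>d0\<bar> + b * (1 - p) * \<bar>d1\<bar> + p * (1 - p) * D * \<bar>dz / z\<bar>"
    proof -
      have abs3: "\<bar>x - y - t\<bar> \<le> \<bar>x\<bar> + \<bar>y\<bar> + \<bar>t\<bar>" for x y t :: real by linarith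
      have eqs: "\<bar>p * d0\<bar> = p * \<bar>d0\<bar>" "\<bar>b * (1 - p) * d1\<bar> = b * (1 - p) * \<bar>d1\<bar>"
        "\<bar>p * (1 - p) * (g0 + b * g1) * (dz / z)\<bar> = p * (1 - p) * D * \<bar>dz / z\<bar>"
        using p01 b by (simp_all add: abs_mult D_def)
      show ?thesis unfolding dF_def
        using abs3[of "p * d0" "b * (1 - p) * d1" "p * (1 - p) * (g0 + b * g1) * (dz / z)"]
        by (simp only: eqs)
    qed
    also have "\<dots> \<le> p * \<bar>d0\<bar> + b * (1 - p) * \<bar>d1\<bar> + p * (1 - p) * D *
        ((b^2 / (1 + b^2 * g0)) * \<bar>d0\<bar> + (b^2 / (1 + b^2 * g1)) * \<bar>d1\<bar>
        + ((1 + b) / ((1 + gu) * (1 - b * gu))) * \<bar>du\<bar>)"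
      using dzz p01 by (intro add_left_mono mult_left_mono) (auto simp: D_def)
    also have "\<dots> \<le> p * (pot_weight g0 * (2/5 * e)) + b * (1 - p) * (pot_weight g1 * (2/5 * e)) + p * (1 - p) * D *
        ((b^2 / (1 + b^2 * g0)) * (pot_weight g0 * (2/5 * e)) + (b^2 / (1 + b^2 * g1)) * (pot_weight g1 * (2/5 * e))
        + ((1 + b) / ((1 + gu) * (1 - b * gu))) * (pot_weight gu * (2/5 * e)))"
      using da p01 b cpos by (intro add_mono mult_left_mono) (auto simp: D_def)
    also have "\<dots> = ((p + p * (1 - p) * D * (b^2 / (1 + b^2 * g0))) * pot_weight g0
     + (1 - p) * (b + p * D * (b^2 / (1 + b^2 * g1))) * pot_weight g1
     + p * (1 - p) * D * ((1 + b) / ((1 + gu) * (1 - b * gu))) * pot_weight gu) * (2/5 * e)"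
      by (rule regroup)
    also have "\<dots> \<le> (pot_weight F - 17/50 * (1 - p)) * (2/5 * e)"
      unfolding Fp D_def using key_inequality[OF b p01 r0 r1 ru] e0
      by (intro mult_right_mono) auto
    also have "\<dots> \<le> (?k * pot_weight F) * (2/5 * e)"
    proof -
      \<comment> \<open>From z \<ge> lam follows 1 - p \<ge> lam / (1 + lam). The rate 1/5 is chosen
        so that 1/5 * 8/5 \<le> 17/50, where 8/5 bounds \<open>pot_weight\<close>.\<close>
      define x where "x = lam / (1 + lam)"
      have x1: "x \<le> 1 - p" unfolding pz x_def using zl l zpos by (simp add: field_simps)
      have x2: "0 \<le> x" unfolding x_def using l by simp
      have x3: "x * pot_weight F \<le> x * (8/5)" using x2 pot_weight_le by (intro mult_left_mono) auto
      have x4: "lam / (5 * (1 + lam)) = x / 5" unfolding x_def by simp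
      have "lam / (5 * (1 + lam)) * pot_weight F \<le> 17/50 * (1 - p)"
        unfolding x4 using x1 x2 x3 by argo
      then show ?thesis using e0 by (intro mult_right_mono) (auto simp: algebra_simps)
    qed
    finally have dFb: "\<bar>dF\<bar> \<le> (?k * pot_weight F) * (2/5 * e)" .
    have "\<bar>(5/2) / pot_weight F * dF\<bar> = (5/2) / pot_weight F * \<bar>dF\<bar>" using wpos by (simp add: abs_mult)
    also have "\<dots> \<le> (5/2) / pot_weight F * ((?k * pot_weight F) * (2/5 * e))"
      using dFb wpos by (intro mult_left_mono) auto
    also have "\<dots> = ?k * e" using wpos by simp
    finally show ?thesis using Dh by blast
  qed
  then obtain h' where h': "\<And>s. 0 \<le> s \<Longrightarrow> s \<le> 1 \<Longrightarrow> (h has_real_derivative h' s) (at s)"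
    "\<And>s. 0 \<le> s \<Longrightarrow> s \<le> 1 \<Longrightarrow> \<bar>h' s\<bar> \<le> ?k * e" by metis
  obtain s where s: "0 < s" "s < 1" "h 1 - h 0 = (1 - 0) * h' s"
    using MVT2[of 0 1 h h'] h'(1) by auto
  have "\<bar>h 1 - h 0\<bar> \<le> ?k * e" using s h'(2)[of s] by simp
  then show ?thesis unfolding h_def using path0 path1 S0 S1 Su X0 X1 Xu by simp
qed

section \<open>The recursion for marginal ratios\<close>

text \<open>
  A vertex enters only through \<open>x = f\<^sub>1/f\<^sub>0\<close>; pinning one of its half-edges to \<open>1\<close> turns this into
  \<open>f\<^sub>2/f\<^sub>1 = c + 1/x\<close>, and pinning one to \<open>0\<close> leaves it unchanged.
\<close>
definition shift :: "real \<Rightarrow> real \<Rightarrow> real" where "shift c x = c + 1 / x"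

type_synonym edge = "nat \<times> nat \<times> real"

text \<open>The Holant sum with every vertex function divided by its value f_0. Setting an edge to 1
  costs f_1/f_0 at both ends and drops the first entry of their value lists; setting it to 0 drops
  the last entry, which the ratio does not see.\<close>

fun normalized_Z :: "real \<Rightarrow> (nat \<Rightarrow> real) \<Rightarrow> edge list \<Rightarrow> real" where
  "normalized_Z c r [] = 1"
| "normalized_Z c r ((u, v, l) # E) = normalized_Z c r E + l * r u * r v * normalized_Z c (r(u := shift c (r u), v := shift c (r v))) E"

definition edge_ok :: "edge \<Rightarrow> bool" where
  "edge_ok e \<longleftrightarrow> (case e of (u, v, l) \<Rightarrow> u \<noteq> v \<and> 0 < l)"

definition marginal :: "real \<Rightarrow> (nat \<Rightarrow> real) \<Rightarrow> nat \<Rightarrow> edge list \<Rightarrow> real" where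
  "marginal c r v E = r v * normalized_Z c (r(v := shift c (r v))) E / normalized_Z c r E"

lemma shift_pos: "0 < c \<Longrightarrow> 0 < x \<Longrightarrow> 0 < shift c x"
  by (simp add: shift_def add_pos_pos)

lemma mult_shift: "x \<noteq> 0 \<Longrightarrow> x * shift c x = c * x + 1"
  by (simp add: shift_def distrib_left mult.commute)

lemma normalized_Z_pos: "0 < c \<Longrightarrow> (\<And>w. 0 < r w) \<Longrightarrow> \<forall>e\<in>set E. edge_ok e \<Longrightarrow> 0 < normalized_Z c r E"
proof (induction c r E rule: normalized_Z.induct)
  case (2 c r u v l E)
  have "0 < normalized_Z c (r(u := shift c (r u), v := shift c (r v))) E"
    by (rule "2.IH"(2)) (use 2 in \<open>auto simp: shift_pos\<close>)
  moreover have "0 < normalized_Z c r E" by (rule "2.IH"(1)) (use 2 in auto)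
  moreover have "0 < l" "0 < r u" "0 < r v" using 2 by (auto simp: edge_ok_def)
  ultimately show ?case by (simp add: add_pos_pos)
qed simp

text \<open>The recurrence expresses all values at \<open>v\<close> linearly through f_0 = 1 and f_1
  = x; the pole of \<open>shift\<close> is always cancelled by a factor x. It follows that the whole
  graph, as a function of the number of pins at \<open>v\<close>, obeys the same recurrence as a
  single vertex.\<close>

lemma normalized_Z_affine:
  assumes "\<forall>e\<in>set E. edge_ok e" and c: "0 < c"
  shows "\<exists>a b. \<forall>x>0. normalized_Z c (r(v := x)) E = a + b * x"
  using assms(1)
proof (induction E arbitrary: r)
  case Nil
  show ?case by (rule exI[of _ 1], rule exI[of _ 0]) simp
next
  case (Cons e E)
  obtain s t l where e: "e = (s, t, l)" by (cases e) auto
  have st: "s \<noteq> t" using Cons.prems e by (auto simp: edge_ok_def)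
  have okE: "\<forall>e\<in>set E. edge_ok e" using Cons.prems by simp
  obtain a b where ab: "\<And>x. x > 0 \<Longrightarrow> normalized_Z c (r(v := x)) E = a + b * x"
    using Cons.IH[OF okE] by blast
  show ?case
  proof (cases "v = s \<or> v = t")
    case True
    define w where "w = (if v = s then t else s)"
    have vw: "v \<noteq> w" using st True by (auto simp: w_def)
    obtain a' b' where ab': "\<And>x. x > 0 \<Longrightarrow> normalized_Z c ((r(w := shift c (r w)))(v := x)) E = a' + b' * x"
      using Cons.IH[OF okE] by blast
    have "normalized_Z c (r(v := x)) (e # E) = (a + l * r w * b') + (b + l * r w * (a' + b' * c)) * x"
      if x: "x > 0" for x
    proof -
      have "normalized_Z c (r(v := x)) (e # E) = normalized_Z c (r(v := x)) E
          + l * x * r w * normalized_Z c ((r(w := shift c (r w)))(v := shift c x)) E"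
        using True st by (auto simp: e w_def fun_upd_twist)
      also have "\<dots> = a + b * x + l * r w * (x * (a' + b' * (c + 1 / x)))"
        using ab[OF x] ab'[OF shift_pos[OF c x]] by (simp add: shift_def)
      finally show ?thesis using x by (simp add: algebra_simps)
    qed
    then show ?thesis by blast
  next
    case False
    obtain a' b' where ab': "\<And>x. x > 0 \<Longrightarrow>
        normalized_Z c ((r(s := shift c (r s), t := shift c (r t)))(v := x)) E = a' + b' * x"
      using Cons.IH[OF okE] by blast
    have "normalized_Z c (r(v := x)) (e # E) = (a + l * r s * r t * a') + (b + l * r s * r t * b') * x"
      if x: "x > 0" for x
    proof -
      have "normalized_Z c (r(v := x)) (e # E) = normalized_Z c (r(v := x)) E
          + l * r s * r t * normalized_Z c ((r(s := shift c (r s), t := shift c (r t)))(v := x)) E"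
        using False st by (auto simp: e fun_upd_twist)
      then show ?thesis using ab[OF x] ab'[OF x] by (simp add: algebra_simps)
    qed
    then show ?thesis by blast
  qed
qed


section \<open>Removing an edge at a given vertex\<close>

fun pick :: "nat \<Rightarrow> edge list \<Rightarrow> ((nat \<times> real) \<times> edge list) option" where
  "pick v [] = None"
| "pick v ((s, t, l) # E) =
     (if s = v then Some ((t, l), E) else if t = v then Some ((s, l), E)
      else map_option (\<lambda>(p, E'). (p, (s, t, l) # E')) (pick v E))"

lemma pick_Some:
  assumes "pick v E = Some ((u, l), E')"
  shows "length E = Suc (length E')" "set E' \<subseteq> set E" "(u, v, l) \<in> set E \<or> (v, u, l) \<in> set E"
  using assms
proof (induction E arbitrary: E')
  case (Cons e E)
  obtain s t k where e: "e = (s, t, k)" by (cases e) auto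
  { case 1 then show ?case using Cons.IH(1) by (fastforce simp: e split: if_splits) }
  { case 2 then show ?case using Cons.IH(2) by (fastforce simp: e split: if_splits) }
  { case 3 then show ?case using Cons.IH(3) by (fastforce simp: e split: if_splits) }
qed simp_all

text \<open>The definition peels off only the head of the list, but peelings commute: updates at
  different vertices do not interfere, and at a shared end either order multiplies two consecutive
  ratios and shifts twice.\<close>

lemma normalized_Z_pick:
  assumes "pick v E = Some ((u, l), E')" "\<forall>e\<in>set E. edge_ok e"
  shows "normalized_Z c r E = normalized_Z c r E' + l * r v * r u * normalized_Z c (r(v := shift c (r v), u := shift c (r u))) E'"
  using assms
proof (induction E arbitrary: E' r)
  case (Cons e E)
  obtain s t k where e: "e = (s, t, k)" by (cases e) auto
  have st: "s \<noteq> t" using Cons.prems(2) by (auto simp: e edge_ok_def)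
  consider "s = v" | "s \<noteq> v" "t = v" | "s \<noteq> v" "t \<noteq> v" by blast
  then have "normalized_Z c r (e # E) = normalized_Z c r E' + l * r v * r u * normalized_Z c (r(v := shift c (r v), u := shift c (r u))) E'"
  proof cases
    case 1
    then show ?thesis using Cons.prems(1) by (simp add: e)
  next
    case 2
    then show ?thesis using Cons.prems(1) by (simp add: e fun_upd_twist)
  next
    case 3
    then obtain E'' where p: "pick v E = Some ((u, l), E'')" and E': "E' = (s, t, k) # E''"
      using Cons.prems(1) by (auto simp: e)
    have uv: "u \<noteq> v" using pick_Some(3)[OF p] Cons.prems(2) by (auto simp: edge_ok_def)
    have IH: "normalized_Z c r E = normalized_Z c r E'' + l * r v * r u * normalized_Z c (r(v := shift c (r v), u := shift c (r u))) E''" for r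
      by (rule Cons.IH) (use 3 p Cons.prems in auto)
    show ?thesis
      using 3 st uv
      by (cases "u = s"; cases "u = t") (simp_all add: e E' IH fun_upd_twist algebra_simps)
  qed
  then show ?case .
qed simp

lemma normalized_Z_pick_None: "pick v E = None \<Longrightarrow> normalized_Z c (r(v := x)) E = normalized_Z c r E"
proof (induction E arbitrary: r)
  case (Cons e E)
  obtain s t l where e: "e = (s, t, l)" by (cases e) auto
  have nv: "s \<noteq> v" "t \<noteq> v" "pick v E = None" using Cons.prems by (auto simp: e split: if_splits)
  have IH: "normalized_Z c (r(v := x)) E = normalized_Z c r E" for r
    by (rule Cons.IH) (use nv in auto)
  have "r(v := x, s := y, t := y') = r(s := y, t := y', v := x)" for y y'
    using nv by (auto simp: fun_upd_def)
  then have "normalized_Z c (r(v := x)) (e # E) = normalized_Z c r (e # E)" using nv IH by (simp add: e)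
  then show ?case .
qed simp

text \<open>In the notation of \<open>marginal_combine\<close>, \<open>c * R0 + 1\<close> is V2/V0
  and \<open>c * R1 + 1\<close> is U2/U0. The numerator is therefore (V1 + l y U2)/V0 and the
  denominator (V0 + l y U1)/V0.\<close>

definition combine :: "real \<Rightarrow> real \<Rightarrow> real \<Rightarrow> real \<Rightarrow> real \<Rightarrow> real" where
  "combine c l R0 R1 q =
     (R0 + l * q * (c * R0 + 1)) / (1 + l * q * (c * R0 + 1) * R1 / (c * R1 + 1))"

text \<open>
  The third marginal is taken with \<open>v\<close> pinned twice to \<open>1\<close>.  In the limit of infinitely many pins it
  would only depend on \<open>\<alpha>\<close>, which is not computable from \<open>c\<close> by field operations; two pins suffice
  to make the extra dependence on \<open>S0\<close> and \<open>S1\<close>, of order \<open>b\<^sup>2\<close>, harmless for the contraction.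
\<close>
lemma marginal_combine:
  assumes c: "0 < c" and r: "\<And>w. 0 < r w" and ok: "\<forall>e\<in>set E. edge_ok e"
    and p: "pick v E = Some ((u, l), E')"
  shows "marginal c r v E = combine c l (marginal c r v E')
     (marginal c (r(u := shift c (r u))) v E')
     (marginal c (r(v := shift c (shift c (r v)))) u E')"
proof -
  have ok': "\<forall>e\<in>set E'. edge_ok e" using pick_Some(2)[OF p] ok by auto
  have uv: "u \<noteq> v" and l: "l > 0" using pick_Some(3)[OF p] ok by (auto simp: edge_ok_def)
  note pos = shift_pos[OF c]
  define x y where "x = r v" and "y = r u"
  have x: "x > 0" and y: "y > 0" using r by (auto simp: x_def y_def)
  define A where "A = (\<lambda>x. normalized_Z c (r(v := x)) E')"
  define B where "B = (\<lambda>x. normalized_Z c (r(u := shift c y, v := x)) E')"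
  have Apos: "A x > 0" if "x > 0" for x
    unfolding A_def by (rule normalized_Z_pos[OF c _ ok']) (use r that in auto)
  have Bpos: "B x > 0" if "x > 0" for x
    unfolding B_def by (rule normalized_Z_pos[OF c _ ok']) (use r that pos y in auto)
  obtain a0 a1 where a: "\<And>x. x > 0 \<Longrightarrow> A x = a0 + a1 * x"
    unfolding A_def using normalized_Z_affine[OF ok' c] by blast
  obtain b0 b1 where b: "\<And>x. x > 0 \<Longrightarrow> B x = b0 + b1 * x"
    unfolding B_def using normalized_Z_affine[OF ok' c] by blast
  \<comment> \<open>V_i and U_i are the weights of the smaller graph with \<open>v\<close> pinned i
    times to 1 and \<open>u\<close> pinned to 0 or to 1 respectively, in U_i without the factor
    \<open>y\<close>.\<close>
  define V0 V1 V2 where "V0 = A x" and "V1 = x * A (shift c x)"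
    and "V2 = x * shift c x * A (shift c (shift c x))"
  define U0 U1 U2 where "U0 = B x" and "U1 = x * B (shift c x)"
    and "U2 = x * shift c x * B (shift c (shift c x))"
  have xs1: "x * shift c x = c * x + 1" and xs2: "shift c x * shift c (shift c x) = c * shift c x + 1"
    using mult_shift[of x c] mult_shift[of "shift c x" c] x pos[OF x] by simp_all
  have V: "V2 = c * V1 + V0" unfolding V0_def V1_def V2_def
    a[OF x] a[OF pos[OF x]] a[OF pos[OF pos[OF x]]] using xs1 xs2 by algebra
  have U: "U2 = c * U1 + U0" unfolding U0_def U1_def U2_def
    b[OF x] b[OF pos[OF x]] b[OF pos[OF pos[OF x]]] using xs1 xs2 by algebra
  have Vp: "V0 > 0" "V1 > 0" "V2 > 0" and Up: "U0 > 0" "U1 > 0" "U2 > 0"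
    unfolding V0_def V1_def V2_def U0_def U1_def U2_def using x pos Apos Bpos by auto
  have R0: "marginal c r v E' = V1 / V0"
    by (simp add: marginal_def V0_def V1_def A_def x_def)
  have r_id: "r(u := shift c (r u), v := r v) = r(u := shift c (r u))" using uv by auto
  have R1: "marginal c (r(u := shift c (r u))) v E' = U1 / U0"
    using uv by (simp add: marginal_def U0_def U1_def B_def x_def y_def r_id)
  have q: "marginal c (r(v := shift c (shift c (r v)))) u E' = y * U2 / V2"
  proof -
    have "marginal c (r(v := shift c (shift c (r v)))) u E'
        = y * B (shift c (shift c x)) / A (shift c (shift c x))"
      using uv by (simp add: marginal_def A_def B_def x_def y_def fun_upd_twist)
    also have "\<dots> = y * U2 / V2" unfolding U2_def V2_def using x pos[OF x] by simp
    finally show ?thesis .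
  qed
  have W0: "normalized_Z c r E = V0 + l * y * U1"
    unfolding normalized_Z_pick[OF p ok] using uv
    by (simp add: V0_def U1_def A_def B_def x_def y_def fun_upd_twist)
  have W1: "r v * normalized_Z c (r(v := shift c (r v))) E = V1 + l * y * U2"
    unfolding normalized_Z_pick[OF p ok] using uv
    by (simp add: V1_def U2_def A_def B_def x_def y_def fun_upd_twist algebra_simps)
  have "c * (V1 / V0) + 1 = V2 / V0" and "c * (U1 / U0) + 1 = U2 / U0"
    unfolding V U using Vp Up by (auto simp: field_simps)
  then have "combine c l (V1 / V0) (U1 / U0) (y * U2 / V2) = (V1 / V0 + l * y * U2 / V0) / (1 + l * y * U1 / V0)"
    unfolding combine_def using Vp Up by (simp add: mult.assoc)
  also have "\<dots> = ((V1 + l * y * U2) / V0) / ((V0 + l * y * U1) / V0)"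
    using Vp by (simp add: add_divide_distrib)
  also have "\<dots> = (V1 + l * y * U2) / (V0 + l * y * U1)" using Vp by simp
  finally show ?thesis unfolding R0 R1 q marginal_def[of c r v E] W0 W1 by simp
qed

section \<open>The coordinate S of a ratio\<close>

definition of_spin :: "real \<Rightarrow> real \<Rightarrow> real" where
  "of_spin al S = al * (1 - 1 / al^2 * S) / (1 + S)"

definition to_spin :: "real \<Rightarrow> real \<Rightarrow> real" where
  "to_spin al R = (al - R) / (R + 1 / al)"

definition admissible :: "real \<Rightarrow> real \<Rightarrow> bool" where
  "admissible al R \<longleftrightarrow> 0 < R \<and> - (1 / al^2) \<le> to_spin al R \<and> to_spin al R \<le> 1"

text \<open>The bound 29/10 is what c \<ge> 2.57 provides; its square exceeds 25/3, whence
  \<open>b \<le> 3/25\<close>.\<close>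

locale fib =
  fixes al c :: real
  assumes al: "29/10 \<le> al" and c: "c = al - 1 / al"
begin

abbreviation b where "b \<equiv> 1 / al^2"

lemma b_bounds: "0 < b" "b \<le> 3/25"
proof -
  have "al^2 \<ge> (29/10)^2" using al by (intro power_mono) auto
  then have "al^2 \<ge> 25/3" by (simp add: power2_eq_square)
  moreover from this have "al^2 > 0" by linarith
  ultimately show "0 < b" "b \<le> 3/25" by (auto simp: divide_le_eq)
qed

lemma al_pos: "0 < al" using al by simp

lemma c_eq: "c = al * (1 - b)" using al_pos unfolding c by (simp add: field_simps power2_eq_square)

lemma c_pos: "0 < c"
  unfolding c_eq using al_pos b_bounds by (intro mult_pos_pos) linarith+

lemma alb: "al * b = 1 / al" using al_pos by (simp add: power2_eq_square)

lemma of_to_spin: "0 < R \<Longrightarrow> of_spin al (to_spin al R) = R"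
proof -
  assume R: "0 < R"
  have p: "R + 1 / al > 0" using R al_pos by (simp add: add_pos_pos)
  have "1 + to_spin al R = (al + 1 / al) / (R + 1 / al)"
    unfolding to_spin_def using p by (simp add: add_divide_distrib[symmetric] add_divide_eq_iff)
  moreover have "al * (1 - b * to_spin al R) = (al + 1 / al) * R / (R + 1 / al)"
  proof -
    have "al * (1 - b * to_spin al R) = al - al * b * (al - R) / (R + 1 / al)"
      unfolding to_spin_def by (simp add: algebra_simps)
    also have "\<dots> = (al * (R + 1 / al) - 1 / al * (al - R)) / (R + 1 / al)"
      unfolding alb using p by (simp add: diff_divide_distrib)
    also have "al * (R + 1 / al) - 1 / al * (al - R) = (al + 1 / al) * R"
      using al_pos by (simp add: field_simps)
    finally show ?thesis .
  qed
  moreover have "al + 1 / al > 0" using al_pos by (simp add: add_pos_pos)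
  ultimately show ?thesis unfolding of_spin_def using p by simp
qed

lemma to_of_spin:
  assumes "-1 < S"
  shows "to_spin al (of_spin al S) = S"
proof -
  have S: "1 + S > 0" using assms by simp
  have "al - of_spin al S = al * (1 + b) * S / (1 + S)"
    unfolding of_spin_def using S by (simp add: diff_divide_eq_iff divide_diff_eq_iff) (simp add: algebra_simps add_divide_distrib diff_divide_distrib)
  moreover have "of_spin al S + 1 / al = al * (1 + b) / (1 + S)"
    unfolding of_spin_def alb[symmetric] using S by (simp add: add_divide_eq_iff divide_add_eq_iff) (simp add: algebra_simps add_divide_distrib diff_divide_distrib)
  moreover have "al * (1 + b) > 0" using al_pos b_bounds by (intro mult_pos_pos) linarith+
  moreover have "k * S / (1 + S) / (k / (1 + S)) = S" if "k > 0" for k using that S by simp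
  ultimately show ?thesis unfolding to_spin_def by metis
qed

lemma admissible_of_spin:
  assumes "-b \<le> S" "S \<le> 1"
  shows "admissible al (of_spin al S)"
proof -
  have "b * S \<le> b" using mult_left_mono[of S 1 b] b_bounds assms by simp
  then have "1 - b * S > 0" using b_bounds by linarith
  then have "of_spin al S > 0" unfolding of_spin_def using al_pos b_bounds assms by simp
  then show ?thesis unfolding admissible_def using to_of_spin assms b_bounds by simp
qed

text \<open>In the coordinate S the expression \<open>c * R + 1\<close> becomes al^2 (1 + b^2 S) /
  (1 + S). With z the edge odds, numerator and denominator of the step turn into multiples of (1 - b
  F)(1 + z) and (1 + F)(1 + z), so the new coordinate is exactly F.\<close>

lemma combine_spin:
  assumes l: "0 < l" and R0: "admissible al R0" and R1: "admissible al R1" and q: "admissible al q"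
  shows "combine c l R0 R1 q = of_spin al (spin_step b l (to_spin al R0) (to_spin al R1) (to_spin al q))"
proof -
  define S0 S1 Su where "S0 = to_spin al R0" and "S1 = to_spin al R1" and "Su = to_spin al q"
  have R: "R0 = of_spin al S0" "R1 = of_spin al S1" "q = of_spin al Su"
    using R0 R1 q by (auto simp: S0_def S1_def Su_def of_to_spin admissible_def)
  have r: "-b \<le> S0" "S0 \<le> 1" "-b \<le> S1" "S1 \<le> 1" "-b \<le> Su" "Su \<le> 1"
    using R0 R1 q by (auto simp: S0_def S1_def Su_def admissible_def)
  define z where "z = edge_odds b l S0 S1 Su"
  have z: "z > 0" using edge_odds_ge[OF b_bounds l r] l by (simp add: z_def)
  have b2: "b^2 \<le> 9/625" using power_mono[of b "3/25" 2] b_bounds by (simp add: power2_eq_square)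
  have pos: "1 + S0 > 0" "1 + S1 > 0" "1 + Su > 0" using r b_bounds by auto
  have bS: "b * S \<le> b" if "S \<le> 1" for S using mult_left_mono[of S 1 b] b_bounds that by simp
  have b2S: "b^2 * S \<ge> -(b^2)" if "-b \<le> S" for S
    using mult_left_mono[of "-1" S "b^2"] b_bounds that by simp
  have pos': "1 - b * S1 > 0" "1 - b * Su > 0" "1 + b^2 * S0 > 0" "1 + b^2 * S1 > 0"
    using bS[OF r(4)] bS[OF r(6)] b2S[OF r(1)] b2S[OF r(3)] b2 b_bounds by linarith+
  have aab: "al * al * b = 1" using al_pos by (simp add: power2_eq_square)
  have cR: "c * of_spin al S + 1 = al^2 * (1 + b^2 * S) / (1 + S)" if "1 + S > 0" for S
  proof -
    have "c * of_spin al S + 1 = (al * al * (1 - b) * (1 - b * S) + (1 + S)) / (1 + S)"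
      unfolding c_eq of_spin_def using that by (simp add: add_divide_distrib)
    also have "al * al * (1 - b) * (1 - b * S) + (1 + S) = al^2 * (1 + b^2 * S)"
      using aab by algebra
    finally show ?thesis .
  qed
  have lq: "l * q * (1 + b^2 * S0) = z * (1 + b^2 * S1) / al"
  proof -
    have "z * (1 + b^2 * S1) / al = l / (al * b) * ((1 - b * Su) / (1 + Su)) * (1 + b^2 * S0)"
      unfolding z_def edge_odds_def using pos' by simp
    also have "l / (al * b) = l * al" using al_pos by (simp add: power2_eq_square)
    finally show ?thesis unfolding R of_spin_def by simp
  qed
  have 1: "l * q * (c * R0 + 1) = al * z * (1 + b^2 * S1) / (1 + S0)"
  proof -
    have "l * q * (c * R0 + 1) = al^2 * (l * q * (1 + b^2 * S0)) / (1 + S0)"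
      unfolding R(1) cR[OF pos(1)] by simp
    then show ?thesis unfolding lq using al_pos by (simp add: power2_eq_square)
  qed
  have 2: "R1 / (c * R1 + 1) = (1 - b * S1) / (al * (1 + b^2 * S1))"
  proof -
    have "R1 / (c * R1 + 1) = (al * (1 - b * S1)) / (al^2 * (1 + b^2 * S1))"
      unfolding R(2) cR[OF pos(2)] unfolding of_spin_def using pos by simp
    then show ?thesis using al_pos by (simp add: power2_eq_square)
  qed
  have "combine c l R0 R1 q = (R0 + l * q * (c * R0 + 1)) / (1 + l * q * (c * R0 + 1) * (R1 / (c * R1 + 1)))"
    unfolding combine_def by simp
  also have "\<dots> = (al * (1 - b * S0) / (1 + S0) + al * z * (1 + b^2 * S1) / (1 + S0))
      / (1 + z * (1 - b * S1) / (1 + S0))"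
    unfolding 1 2 unfolding R(1) of_spin_def using al_pos pos' by simp
  also have "al * (1 - b * S0) / (1 + S0) + al * z * (1 + b^2 * S1) / (1 + S0)
      = al * (1 - b * S0 + z * (1 + b^2 * S1)) / (1 + S0)"
    by (simp add: add_divide_distrib[symmetric] distrib_left)
  also have "1 + z * (1 - b * S1) / (1 + S0) = (1 + S0 + z * (1 - b * S1)) / (1 + S0)"
    using pos by (simp add: add_divide_distrib)
  also have "al * (1 - b * S0 + z * (1 + b^2 * S1)) / (1 + S0) / ((1 + S0 + z * (1 - b * S1)) / (1 + S0))
      = al * (1 - b * S0 + z * (1 + b^2 * S1)) / (1 + S0 + z * (1 - b * S1))"
    using pos by simp
  also have "\<dots> = of_spin al (spin_step b l S0 S1 Su)"
  proof -
    define F where "F = spin_step b l S0 S1 Su"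
    have F: "F = (S0 - b * z * S1) / (1 + z)" unfolding F_def spin_step_def z_def ..
    have Fz: "F * (1 + z) = S0 - b * z * S1" unfolding F using z by simp
    have "1 - b * S0 + z * (1 + b^2 * S1) = (1 - b * F) * (1 + z)"
      and "1 + S0 + z * (1 - b * S1) = (1 + F) * (1 + z)"
      using Fz by algebra+
    then show ?thesis unfolding of_spin_def F_def[symmetric] using z by simp
  qed
  finally show ?thesis unfolding S0_def S1_def Su_def .
qed

lemma combine_admissible:
  assumes "0 < l" "admissible al R0" "admissible al R1" "admissible al q"
  shows "admissible al (combine c l R0 R1 q)"
    and "to_spin al (combine c l R0 R1 q) = spin_step b l (to_spin al R0) (to_spin al R1) (to_spin al q)"
proof -
  have r: "-b \<le> spin_step b l (to_spin al R0) (to_spin al R1) (to_spin al q)"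
    "spin_step b l (to_spin al R0) (to_spin al R1) (to_spin al q) \<le> 1"
    using spin_step_range[OF b_bounds] assms by (auto simp: admissible_def)
  show "admissible al (combine c l R0 R1 q)"
    unfolding combine_spin[OF assms] using admissible_of_spin r .
  show "to_spin al (combine c l R0 R1 q) = spin_step b l (to_spin al R0) (to_spin al R1) (to_spin al q)"
    unfolding combine_spin[OF assms] using to_of_spin r b_bounds by simp
qed

text \<open>The end c/2 has S = 1. The other end c + 2/c is \<open>shift c (c / 2)\<close> and has S
  = -b, because \<open>shift\<close> multiplies S by -b. So the interval of the theorem is exactly
  -b \<le> S \<le> 1.\<close>

lemma admissible_range:
  assumes "c / 2 \<le> R" "R \<le> c + 2 / c"
  shows "admissible al R"
proof -
  have R: "R > 0" using assms(1) c_pos by simp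
  have p: "R + 1 / al > 0" using R al_pos by (simp add: add_pos_pos)
  have "to_spin al R \<le> 1" unfolding to_spin_def using p assms(1) c by (simp add: divide_le_eq)
  moreover have "-b \<le> to_spin al R"
  proof -
    have "R * c \<le> (c + 2 / c) * c" using assms(2) c_pos by (intro mult_right_mono) auto
    also have "\<dots> = c^2 + 2" using c_pos by (simp add: field_simps power2_eq_square)
    also have "\<dots> = al * (al + b * (1 / al))" unfolding c using al_pos by (simp add: field_simps power2_eq_square)
    finally have "R * (al * (1 - b)) \<le> al * (al + b * (1 / al))" unfolding c_eq .
    then have "al * (R * (1 - b)) \<le> al * (al + b * (1 / al))" by (simp add: mult_ac)
    then have "R * (1 - b) \<le> al + b * (1 / al)" using al_pos by (simp only: mult_le_cancel_left_pos)
    moreover have "- \<beta> * (R + y) \<le> al - R" if "R * (1 - \<beta>) \<le> al + \<beta> * y" for \<beta> y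
      using that by (simp add: algebra_simps)
    ultimately have "- b * (R + 1 / al) \<le> al - R" by blast
    then show ?thesis unfolding to_spin_def using p by (simp only: pos_le_divide_eq)
  qed
  ultimately show ?thesis using R by (simp add: admissible_def)
qed

text \<open>Dropping the first term of a Fibonacci sequence multiplies its decaying part by -b
  relative to the growing one. So S becomes -b S, which lies between -b and b.\<close>

lemma admissible_shift:
  assumes "admissible al R"
  shows "admissible al (shift c R)"
proof -
  define S where "S = to_spin al R"
  have S: "-b \<le> S" "S \<le> 1" and R: "R = of_spin al S" using assms by (auto simp: admissible_def S_def of_to_spin)
  have bS: "b * S \<le> b" using mult_left_mono[of S 1 b] b_bounds S by simp
  then have p: "1 - b * S > 0" using b_bounds by linarith
  have aab: "al * al * b = 1" using al_pos by (simp add: power2_eq_square)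
  have "shift c R = al * (1 - b) + (1 + S) / (al * (1 - b * S))"
    unfolding shift_def R of_spin_def c_eq by simp
  also have "\<dots> = (al * al * (1 - b) * (1 - b * S) + (1 + S)) / (al * (1 - b * S))"
    using al_pos p by (simp add: add_divide_distrib)
  also have "al * al * (1 - b) * (1 - b * S) + (1 + S) = al * (al * (1 + b * b * S))"
    using aab by algebra
  also have "al * (al * (1 + b * b * S)) / (al * (1 - b * S)) = of_spin al (- b * S)"
    unfolding of_spin_def using al_pos by simp
  finally have sh: "shift c R = of_spin al (- b * S)" .
  have "-b \<le> - b * S" using bS by simp
  moreover have "- b * S \<le> b"
    using mult_left_mono[of "-1" S b] b_bounds S by simp
  ultimately show ?thesis unfolding sh using b_bounds by (intro admissible_of_spin) auto
qed

lemma admissible_pos: "admissible al R \<Longrightarrow> 0 < R" by (simp add: admissible_def)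

end

section \<open>The truncated recursion and its error\<close>

text \<open>At depth 0 the value \<open>r v\<close> is merely some admissible guess. If no edge is
  left at \<open>v\<close>, the same value is the exact marginal.\<close>

fun approx :: "real \<Rightarrow> nat \<Rightarrow> (nat \<Rightarrow> real) \<Rightarrow> nat \<Rightarrow> edge list \<Rightarrow> real" where
  "approx c 0 r v E = r v"
| "approx c (Suc L) r v E = (case pick v E of None \<Rightarrow> r v
     | Some ((u, l), E') \<Rightarrow> combine c l (approx c L r v E')
         (approx c L (r(u := shift c (r u))) v E')
         (approx c L (r(v := shift c (shift c (r v)))) u E'))"

text \<open>The factor of an edge is Z with it over Z without it. The joint pinning of both ends is
  split by the chain rule, so the second marginal is taken with \<open>u\<close> already pinned to
  1.\<close>

fun approx_Z :: "real \<Rightarrow> nat \<Rightarrow> (nat \<Rightarrow> real) \<Rightarrow> edge list \<Rightarrow> real" where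
  "approx_Z c L r [] = 1"
| "approx_Z c L r ((u, v, l) # E) =
     (1 + l * approx c L r u E * approx c L (r(u := shift c (r u))) v E) * approx_Z c L r E"

context fib
begin

lemma admissible_marginal:
  assumes "\<And>w. admissible al (r w)" "\<forall>e\<in>set E. edge_ok e"
  shows "admissible al (marginal c r v E)"
  using assms
proof (induction "length E" arbitrary: r v E)
  case 0
  then show ?case by (simp add: marginal_def)
next
  case (Suc n)
  have rp: "0 < r w" for w using Suc.prems(1) by (simp add: admissible_def)
  show ?case
  proof (cases "pick v E")
    case None
    have "normalized_Z c r E > 0" by (rule normalized_Z_pos[OF c_pos rp Suc.prems(2)])
    then show ?thesis using Suc.prems(1) by (simp add: marginal_def normalized_Z_pick_None[OF None])
  next
    case (Some a)
    obtain u l E' where p: "pick v E = Some ((u, l), E')" using Some by (cases a) auto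
    have ok': "\<forall>e\<in>set E'. edge_ok e" using pick_Some(2)[OF p] Suc.prems(2) by auto
    have l: "l > 0" using pick_Some(3)[OF p] Suc.prems(2) by (auto simp: edge_ok_def)
    have n: "n = length E'" using pick_Some(1)[OF p] Suc.hyps(2) by simp
    show ?thesis unfolding marginal_combine[OF c_pos rp Suc.prems(2) p]
      by (intro combine_admissible l Suc.hyps(1)[OF n] ok') (simp_all add: Suc.prems(1) admissible_shift)
  qed
qed

lemma admissible_approx:
  assumes "\<And>w. admissible al (r w)" "\<forall>e\<in>set E. edge_ok e"
  shows "admissible al (approx c L r v E)"
  using assms
proof (induction L arbitrary: r v E)
  case (Suc L)
  show ?case
  proof (cases "pick v E")
    case None
    then show ?thesis using Suc.prems(1) by simp
  next
    case (Some a)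
    obtain u l E' where p: "pick v E = Some ((u, l), E')" using Some by (cases a) auto
    have ok': "\<forall>e\<in>set E'. edge_ok e" using pick_Some(2)[OF p] Suc.prems(2) by auto
    have l: "l > 0" using pick_Some(3)[OF p] Suc.prems(2) by (auto simp: edge_ok_def)
    have "admissible al (combine c l (approx c L r v E') (approx c L (r(u := shift c (r u))) v E')
         (approx c L (r(v := shift c (shift c (r v)))) u E'))"
      by (intro combine_admissible l Suc.IH ok') (simp_all add: Suc.prems(1) admissible_shift)
    then show ?thesis using p by simp
  qed
qed simp

text \<open>The diameter of the interval serves as the error at depth 0. The constant is generous;
  it only affects the depth by an additive term.\<close>

lemma pot_diff_le:
  assumes "-b \<le> S" "S \<le> 1" "-b \<le> T" "T \<le> 1"
  shows "\<bar>pot S - pot T\<bar> \<le> 7"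
proof -
  have "pot (-b) \<le> pot S" "pot S \<le> pot 1" "pot (-b) \<le> pot T" "pot T \<le> pot 1"
    using assms b_bounds by (intro pot_mono; linarith)+
  moreover have "pot 1 - pot (-b) \<le> 7"
  proof -
    have p: "1 - b \<ge> 22/25" "3/2 + b \<le> 81/50" "3/2 + b > 0" using b_bounds by linarith+
    have "pot 1 \<le> 3"
      using ln_le_minus_one[of 2] ln_le_minus_one[of "2::real"] unfolding pot_def
      by (simp add: ln_div)
    moreover have "- pot (-b) \<le> 1"
    proof -
      have "- pot (-b) = ln ((3/2 + b) / (1 - b))" unfolding pot_def
        using p ln_divide_pos[of "3/2 + b" "1 - b"] by simp
      also have "\<dots> \<le> (3/2 + b) / (1 - b) - 1" using p by (intro ln_le_minus_one) auto
      also have "(3/2 + b) / (1 - b) \<le> 2"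
      proof -
        have "3/2 + b \<le> 2 * (1 - b)" "0 < 1 - b" using p by argo+
        then show ?thesis by (simp only: pos_divide_le_eq)
      qed
      finally show ?thesis by simp
    qed
    ultimately show ?thesis by linarith
  qed
  ultimately show ?thesis by linarith
qed

text \<open>The exact and the truncated recursion apply the same step, so every level gains the
  contraction factor. The rate may be any upper bound \<open>kap\<close>, as the program will need a
  rational one.\<close>

lemma approx_error:
  assumes "\<And>w. admissible al (r w)" "\<forall>e\<in>set E. edge_ok e \<and> lam \<le> snd (snd e)"
    and lam: "0 < lam" and kap: "1 - lam / (5 * (1 + lam)) \<le> kap"
  shows "\<bar>pot (to_spin al (approx c L r v E)) - pot (to_spin al (marginal c r v E))\<bar> \<le> 7 * kap ^ L"
  using assms(1,2)
proof (induction L arbitrary: r v E)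
  case 0
  then have "admissible al (marginal c r v E)" by (intro admissible_marginal) auto
  then show ?case using 0(1)[of v] pot_diff_le by (simp add: admissible_def)
next
  case (Suc L)
  have k0: "0 \<le> 1 - lam / (5 * (1 + lam))" using lam by (simp add: field_simps)
  have rp: "0 < r w" for w using Suc.prems(1) by (simp add: admissible_def)
  have okE: "\<forall>e\<in>set E. edge_ok e" using Suc.prems(2) by auto
  show ?case
  proof (cases "pick v E")
    case None
    have "normalized_Z c r E > 0" by (rule normalized_Z_pos[OF c_pos rp okE])
    then have "marginal c r v E = r v" by (simp add: marginal_def normalized_Z_pick_None[OF None])
    then show ?thesis using None k0 kap by simp
  next
    case (Some a)
    obtain u l E' where p: "pick v E = Some ((u, l), E')" using Some by (cases a) auto
    have ok': "\<forall>e\<in>set E'. edge_ok e \<and> lam \<le> snd (snd e)" and okE': "\<forall>e\<in>set E'. edge_ok e"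
      using pick_Some(2)[OF p] Suc.prems(2) by auto
    have l: "lam \<le> l" "0 < l" using pick_Some(3)[OF p] Suc.prems(2) by (auto simp: edge_ok_def)
    let ?r1 = "r(u := shift c (r u))" and ?ru = "r(v := shift c (shift c (r v)))"
    have g: "admissible al (r w)" "admissible al (?r1 w)" "admissible al (?ru w)" for w
      using Suc.prems(1) by (auto intro!: admissible_shift)
    have A: "admissible al (approx c L r v E')" "admissible al (approx c L ?r1 v E')" "admissible al (approx c L ?ru u E')"
      by (intro admissible_approx g okE')+
    have M: "admissible al (marginal c r v E')" "admissible al (marginal c ?r1 v E')" "admissible al (marginal c ?ru u E')"
      by (intro admissible_marginal g okE')+
    have a: "approx c (Suc L) r v E = combine c l (approx c L r v E') (approx c L ?r1 v E') (approx c L ?ru u E')"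
      using p by simp
    have "\<bar>pot (to_spin al (approx c (Suc L) r v E)) - pot (to_spin al (marginal c r v E))\<bar>
        \<le> (1 - lam / (5 * (1 + lam))) * (7 * kap ^ L)"
      unfolding a marginal_combine[OF c_pos rp okE p] combine_admissible(2)[OF l(2) A] combine_admissible(2)[OF l(2) M]
      by (intro spin_step_contraction b_bounds lam l Suc.IH ok')
        (use A M g in \<open>auto simp: admissible_def\<close>)
    also have "\<dots> \<le> kap * (7 * kap ^ L)" using kap k0 by (intro mult_right_mono) auto
    finally show ?thesis by simp
  qed
qed

text \<open>Transfers errors from the metric to relative errors of the ratios. In terms of
  derivatives, b/(1 - b S) + 1/(1 + S) is at most 1/(3/2 - S) + 1/(1 + S), because 3/2 * b \<le>
  1.\<close>

lemma ln_of_spin_diff: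
  assumes "-b \<le> S" "S \<le> T" "T \<le> 1"
  shows "\<bar>ln (of_spin al S) - ln (of_spin al T)\<bar> \<le> \<bar>pot S - pot T\<bar>"
proof -
  have bS: "b * X \<le> b" if "X \<le> 1" for X using mult_left_mono[of X 1 b] b_bounds that by simp
  have p: "1 - b * S > 0" "1 - b * T > 0" "1 + S > 0" "1 + T > 0" "3/2 - S > 0" "3/2 - T > 0"
    using bS[of S] bS[of T] b_bounds assms by linarith+
  have l: "ln (of_spin al X) = ln al + ln (1 - b * X) - ln (1 + X)" if "1 - b * X > 0" "1 + X > 0" for X
    unfolding of_spin_def using that al_pos by (simp only: ln_divide_pos ln_mult_pos mult_pos_pos)
  have "b * S \<le> b * T" using b_bounds assms by (intro mult_left_mono) auto
  then have 1: "ln (1 - b * T) \<le> ln (1 - b * S)" using p by simp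
  have 2: "ln (1 + S) \<le> ln (1 + T)" using p assms by simp
  have "ln ((1 - b * S) * (3/2 - T)) \<le> ln ((3/2 - S) * (1 - b * T))"
  proof -
    have "0 \<le> (T - S) * (1 - 3/2 * b)" using assms b_bounds by (intro mult_nonneg_nonneg) linarith+
    moreover have "(3/2 - S) * (1 - b * T) - (1 - b * S) * (3/2 - T) = (T - S) * (1 - 3/2 * b)"
      by algebra
    ultimately have "(1 - b * S) * (3/2 - T) \<le> (3/2 - S) * (1 - b * T)" by linarith
    then show ?thesis using p by (intro ln_mono mult_pos_pos)
  qed
  with p have 3: "ln (1 - b * S) + ln (3/2 - T) \<le> ln (3/2 - S) + ln (1 - b * T)"
    by (simp only: ln_mult_pos)
  show ?thesis unfolding l[OF p(1,3)] l[OF p(2,4)] pot_def using 1 2 3 by linarith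
qed

lemma ln_diff_le_pot:
  assumes "admissible al R" "admissible al Q"
  shows "\<bar>ln R - ln Q\<bar> \<le> \<bar>pot (to_spin al R) - pot (to_spin al Q)\<bar>"
proof -
  have "R = of_spin al (to_spin al R)" "Q = of_spin al (to_spin al Q)"
    using assms by (auto simp: admissible_def of_to_spin)
  then show ?thesis
    using ln_of_spin_diff[of "to_spin al R" "to_spin al Q"] ln_of_spin_diff[of "to_spin al Q" "to_spin al R"] assms
    by (cases "to_spin al R \<le> to_spin al Q") (simp_all add: admissible_def abs_minus_commute)
qed

text \<open>The map from ln A + ln B to ln (1 + l A B) is 1-Lipschitz for every l > 0, so large edge
  weights do not amplify errors. Two marginals per edge with error 7 each give 14.\<close>

lemma approx_Z_error:
  assumes g: "\<And>w. admissible al (r w)" and E: "\<forall>e\<in>set E. edge_ok e \<and> lam \<le> snd (snd e)"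
    and lam: "0 < lam" and kap: "1 - lam / (5 * (1 + lam)) \<le> kap"
  shows "0 < approx_Z c L r E \<and> \<bar>ln (approx_Z c L r E) - ln (normalized_Z c r E)\<bar> \<le> 14 * kap ^ L * length E"
  using E
proof (induction E)
  case (Cons e E)
  obtain u v l where e: "e = (u, v, l)" by (cases e) auto
  have okE: "\<forall>e\<in>set E. edge_ok e \<and> lam \<le> snd (snd e)" "\<forall>e\<in>set E. edge_ok e" using Cons.prems by auto
  have uv: "u \<noteq> v" "0 < l" using Cons.prems e by (auto simp: edge_ok_def)
  have rp: "0 < r w" for w using g by (simp add: admissible_def)
  let ?r = "r(u := shift c (r u))"
  have g': "admissible al (?r w)" for w using g by (auto intro!: admissible_shift)
  have rp': "0 < ?r w" for w using g' by (simp only: admissible_def)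
  define A B M N where "A = approx c L r u E" and "B = approx c L ?r v E"
    and "M = marginal c r u E" and "N = marginal c ?r v E"
  have gd: "admissible al A" "admissible al B" "admissible al M" "admissible al N"
    unfolding A_def B_def M_def N_def
    by (intro admissible_approx admissible_marginal g g' okE(2))+
  have pos: "0 < A" "0 < B" "0 < M" "0 < N" using gd by (auto simp: admissible_def)
  define d where "d = 7 * kap ^ L"
  have dA: "\<bar>ln A - ln M\<bar> \<le> d" unfolding d_def
    using ln_diff_le_pot[OF gd(1,3)] approx_error[of r E lam kap L u] g okE(1) lam kap by (simp add: A_def M_def)
  have dB: "\<bar>ln B - ln N\<bar> \<le> d" unfolding d_def
    using ln_diff_le_pot[OF gd(2,4)] approx_error[of ?r E lam kap L v] g' okE(1) lam kap by (simp add: B_def N_def)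
  have Wp: "normalized_Z c r E > 0" "normalized_Z c ?r E > 0" by (rule normalized_Z_pos[OF c_pos rp okE(2)] normalized_Z_pos[OF c_pos rp' okE(2)])+
  have We: "normalized_Z c r (e # E) = (1 + l * M * N) * normalized_Z c r E"
    unfolding e M_def N_def marginal_def using uv Wp by (simp add: distrib_right)
  have "\<bar>ln (1 + l * A * B) - ln (1 + l * M * N)\<bar> \<le> 2 * d"
  proof -
    have le: "ln (1 + l * A * B) \<le> ln (1 + l * M * N) + 2 * d"
      if "ln A - ln M \<le> d" "ln B - ln N \<le> d" "0 \<le> d" "0 < A" "0 < B" "0 < M" "0 < N" for A B M N d
    proof -
      have "A * B = exp (ln A + ln B)" using that by (simp add: exp_add)
      also have "\<dots> \<le> exp (ln M + ln N + 2 * d)" using that by simp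
      also have "\<dots> = M * N * exp (2 * d)" using that by (simp add: exp_add)
      finally have "l * (A * B) \<le> l * (M * N * exp (2 * d))" using uv by (intro mult_left_mono) auto
      moreover have "1 \<le> exp (2 * d)" using that by simp
      moreover have "(1 + l * M * N) * exp (2 * d) = exp (2 * d) + l * (M * N * exp (2 * d))"
        by (simp add: algebra_simps)
      moreover have "l * A * B = l * (A * B)" by simp
      ultimately have "1 + l * A * B \<le> (1 + l * M * N) * exp (2 * d)" by linarith
      moreover have p: "0 < 1 + l * A * B" "0 < 1 + l * M * N" using that uv by (auto intro!: add_pos_pos)
      ultimately have "ln (1 + l * A * B) \<le> ln ((1 + l * M * N) * exp (2 * d))" by (intro ln_mono)
      also have "\<dots> = ln (1 + l * M * N) + 2 * d" using p by (simp add: ln_mult)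
      finally show ?thesis .
    qed
    have "0 \<le> d" using dA by linarith
    then show ?thesis using le[of A M d B N] le[of M A d N B] dA dB pos by (simp add: abs_le_iff)
  qed
  moreover have aW: "approx_Z c L r (e # E) = (1 + l * A * B) * approx_Z c L r E"
    unfolding e A_def B_def by simp
  moreover have IH: "0 < approx_Z c L r E" "\<bar>ln (approx_Z c L r E) - ln (normalized_Z c r E)\<bar> \<le> 14 * kap ^ L * length E"
    using Cons.IH[OF okE(1)] by auto
  moreover have p: "0 < 1 + l * A * B" "0 < 1 + l * M * N" using pos uv by (auto intro!: add_pos_pos)
  moreover have "ln (approx_Z c L r (e # E)) = ln (1 + l * A * B) + ln (approx_Z c L r E)"
    unfolding aW using p IH by (simp add: ln_mult)
  moreover have "ln (normalized_Z c r (e # E)) = ln (1 + l * M * N) + ln (normalized_Z c r E)"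
    unfolding We using p Wp by (simp add: ln_mult)
  moreover have "14 * kap ^ L * length (e # E) = 2 * d + 14 * kap ^ L * length E"
    unfolding d_def by (simp add: algebra_simps)
  ultimately show ?case by (simp only: mult_pos_pos simp_thms)
qed simp

end

section \<open>Partition functions of Fibonacci instances\<close>

text \<open>The sequence f_k/f_0 with initial ratio \<open>x\<close>, written as a product of
  consecutive ratios so that one more edge set to 1 matches one \<open>shift\<close>.\<close>

fun fib_seq :: "real \<Rightarrow> real \<Rightarrow> nat \<Rightarrow> real" where
  "fib_seq c x 0 = 1"
| "fib_seq c x (Suc k) = x * fib_seq c (shift c x) k"

lemma fib_seq_rec:
  assumes "0 < c" "0 < x"
  shows "fib_seq c x (Suc (Suc k)) = c * fib_seq c x (Suc k) + fib_seq c x k"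
  using assms(2)
proof (induction k arbitrary: x)
  case 0
  then show ?case using mult_shift[of x c] by simp
next
  case (Suc k)
  have "fib_seq c (shift c x) (Suc (Suc k)) = c * fib_seq c (shift c x) (Suc k) + fib_seq c (shift c x) k"
    by (rule Suc.IH[OF shift_pos[OF assms(1) Suc.prems]])
  then have "x * fib_seq c (shift c x) (Suc (Suc k))
      = c * (x * fib_seq c (shift c x) (Suc k)) + x * fib_seq c (shift c x) k"
    by (simp add: algebra_simps)
  then show ?case by simp
qed

definition count_at :: "(nat \<Rightarrow> nat \<times> nat) \<Rightarrow> (nat \<Rightarrow> bool) \<Rightarrow> nat list \<Rightarrow> nat \<Rightarrow> nat" where
  "count_at en \<sigma> xs v = length (filter (\<lambda>e. (v = fst (en e) \<or> v = snd (en e)) \<and> \<sigma> e) xs)"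

lemma sum_PiE_bool_insert:
  fixes f :: "(nat \<Rightarrow> bool) \<Rightarrow> real"
  assumes "finite S" "x \<notin> S"
  shows "(\<Sum>\<sigma>\<in>insert x S \<rightarrow>\<^sub>E UNIV. f \<sigma>) = (\<Sum>\<sigma>\<in>S \<rightarrow>\<^sub>E UNIV. f (\<sigma>(x := False)) + f (\<sigma>(x := True)))"
proof -
  have inj: "inj_on (\<lambda>(y, g). g(x := y)) ((UNIV :: bool set) \<times> (S \<rightarrow>\<^sub>E UNIV))"
    using inj_combinator[OF assms(2), of "\<lambda>_. UNIV :: bool set"] by simp
  have "(\<Sum>\<sigma>\<in>insert x S \<rightarrow>\<^sub>E UNIV. f \<sigma>) = (\<Sum>(y, g)\<in>(UNIV :: bool set) \<times> (S \<rightarrow>\<^sub>E UNIV). f (g(x := y)))"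
    unfolding PiE_insert_eq sum.reindex[OF inj] by (simp add: case_prod_beta comp_def)
  also have "\<dots> = (\<Sum>y\<in>UNIV. \<Sum>g\<in>S \<rightarrow>\<^sub>E UNIV. f (g(x := y)))"
    by (simp add: sum.cartesian_product)
  also have "\<dots> = (\<Sum>g\<in>S \<rightarrow>\<^sub>E UNIV. f (g(x := False)) + f (g(x := True)))"
    by (simp add: UNIV_bool sum.distrib)
  finally show ?thesis .
qed

text \<open>The sum is split by the value of the first edge. The value 1 raises the count by one at
  its two distinct ends, and there the successor clause of \<open>fib_seq\<close> yields the factor
  and the shift of \<open>normalized_Z\<close>.\<close>

lemma normalized_Z_eq_sum:
  assumes "distinct xs" "\<forall>e\<in>set xs. fst (en e) < n \<and> snd (en e) < n \<and> fst (en e) \<noteq> snd (en e)"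
  shows "(\<Sum>\<sigma>\<in>set xs \<rightarrow>\<^sub>E UNIV. (\<Prod>e\<in>set xs. w e ^ of_bool (\<sigma> e)) *
      (\<Prod>v<n. fib_seq c (r v) (count_at en \<sigma> xs v)))
    = normalized_Z c r (map (\<lambda>e. (fst (en e), snd (en e), w e)) xs)"
  using assms
proof (induction xs arbitrary: r)
  case Nil
  then show ?case by (simp add: count_at_def)
next
  case (Cons e xs)
  let ?s = "fst (en e)" and ?t = "snd (en e)"
  let ?r = "r(?s := shift c (r ?s), ?t := shift c (r ?t))"
  define T where "T r \<sigma> = (\<Prod>e\<in>set xs. w e ^ of_bool (\<sigma> e)) *
      (\<Prod>v<n. fib_seq c (r v) (count_at en \<sigma> xs v))" for r \<sigma>
  have e: "e \<notin> set xs" and st: "?s < n" "?t < n" "?s \<noteq> ?t" using Cons.prems by auto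
  have IH: "(\<Sum>\<sigma>\<in>set xs \<rightarrow>\<^sub>E UNIV. T r \<sigma>) = normalized_Z c r (map (\<lambda>e. (fst (en e), snd (en e), w e)) xs)" for r
    unfolding T_def using Cons.IH Cons.prems by simp
  have cnt: "count_at en (\<sigma>(e := y)) (e # xs) v =
      (if y \<and> (v = ?s \<or> v = ?t) then Suc (count_at en \<sigma> xs v) else count_at en \<sigma> xs v)" for \<sigma> y v
  proof -
    have "filter (\<lambda>e'. (v = fst (en e') \<or> v = snd (en e')) \<and> (\<sigma>(e := y)) e') xs
        = filter (\<lambda>e'. (v = fst (en e') \<or> v = snd (en e')) \<and> \<sigma> e') xs"
      using e by (intro filter_cong) auto
    then show ?thesis by (simp add: count_at_def)
  qed
  have wp: "(\<Prod>e'\<in>set xs. w e' ^ of_bool ((\<sigma>(e := y)) e')) = (\<Prod>e'\<in>set xs. w e' ^ of_bool (\<sigma> e'))" for \<sigma> y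
    using e by (intro prod.cong) auto
  have F: "(\<Prod>e'\<in>set (e # xs). w e' ^ of_bool ((\<sigma>(e := False)) e')) *
      (\<Prod>v<n. fib_seq c (r v) (count_at en (\<sigma>(e := False)) (e # xs) v)) = T r \<sigma>" for \<sigma>
    using e wp[of \<sigma> False] by (simp add: T_def cnt)
  have fs: "fib_seq c (r v) (count_at en (\<sigma>(e := True)) (e # xs) v)
        = (if v = ?s then r v else 1) * (if v = ?t then r v else 1)
          * fib_seq c (?r v) (count_at en \<sigma> xs v)" for v \<sigma>
    using st by (simp add: cnt)
  have P: "(\<Prod>v<n. if v = s then r v else 1) = r s" if "s < n" for s
    using that prod.delta[of "{..<n}" s r] by simp
  have T: "(\<Prod>e'\<in>set (e # xs). w e' ^ of_bool ((\<sigma>(e := True)) e')) *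
      (\<Prod>v<n. fib_seq c (r v) (count_at en (\<sigma>(e := True)) (e # xs) v)) = w e * r ?s * r ?t * T ?r \<sigma>" for \<sigma>
  proof -
    have "(\<Prod>v<n. fib_seq c (r v) (count_at en (\<sigma>(e := True)) (e # xs) v))
        = r ?s * r ?t * (\<Prod>v<n. fib_seq c (?r v) (count_at en \<sigma> xs v))"
      unfolding fs prod.distrib P[OF st(1)] P[OF st(2)] ..
    then show ?thesis using e wp[of \<sigma> True] by (simp add: T_def)
  qed
  have "(\<Sum>\<sigma>\<in>set (e # xs) \<rightarrow>\<^sub>E UNIV. (\<Prod>e\<in>set (e # xs). w e ^ of_bool (\<sigma> e)) *
      (\<Prod>v<n. fib_seq c (r v) (count_at en \<sigma> (e # xs) v)))
      = (\<Sum>\<sigma>\<in>set xs \<rightarrow>\<^sub>E UNIV. T r \<sigma> + w e * r ?s * r ?t * T ?r \<sigma>)"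
    by (rule sum_PiE_bool_insert[OF finite_set e, where f = "\<lambda>\<sigma>. (\<Prod>e\<in>set (e # xs). w e ^ of_bool (\<sigma> e)) *
      (\<Prod>v<n. fib_seq c (r v) (count_at en \<sigma> (e # xs) v))", folded list.set(2), unfolded F T])
  also have "\<dots> = normalized_Z c r (map (\<lambda>e. (fst (en e), snd (en e), w e)) (e # xs))"
    by (simp add: sum.distrib sum_distrib_left[symmetric] IH)
  finally show ?case .
qed

text \<open>The default \<open>c\<close> lies in the admissible interval. If f_0 = 0, the range
  condition makes the whole function zero, and then the factor f_0 already annihilates the partition
  function.\<close>

definition vertex_ratio :: "real \<Rightarrow> holant_inst \<Rightarrow> nat \<Rightarrow> real" where
  "vertex_ratio c \<Omega> v = (let f = level (degree \<Omega> v) (fn \<Omega> v) in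
     if 0 < degree \<Omega> v \<and> 0 < f 0 then f 1 / f 0 else c)"

definition edge_list :: "holant_inst \<Rightarrow> edge list" where
  "edge_list \<Omega> = map (\<lambda>e. (fst (ends \<Omega> e), snd (ends \<Omega> e), weight \<Omega> e)) [0..<nE \<Omega>]"

lemma fibonacci_level:
  assumes c: "0 < c" and F: "(d, F) \<in> fibonacci c"
    and p: "0 < x" and f1: "0 < d \<Longrightarrow> level d F 1 = x * level d F 0" and k: "k \<le> d"
  shows "level d F k = level d F 0 * fib_seq c x k"
  using k
proof (induction k rule: less_induct)
  case (less k)
  consider "k = 0" | "k = 1" | j where "k = Suc (Suc j)"
    by (metis One_nat_def not0_implies_Suc)
  then show ?case
  proof cases
    case 3
    have "level d F k = c * level d F (Suc j) + level d F j"
      using F less.prems 3 by (auto simp: fibonacci_def)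
    also have "\<dots> = level d F 0 * fib_seq c x k"
      using less.IH[of "Suc j"] less.IH[of j] less.prems fib_seq_rec[OF c p, of j]
      by (simp add: 3 algebra_simps del: fib_seq.simps)
    finally show ?thesis .
  qed (use f1 less.prems in auto)
qed

lemma count_list_map_filter: "count_list (map \<sigma> (filter P xs)) True = length (filter (\<lambda>e. P e \<and> \<sigma> e) xs)"
  by (induction xs) auto

lemma partition_function_eq:
  assumes c: "0 < c" and \<Omega>: "\<Omega> \<in> Holant (fibonacci_range c (c / 2) (c + 2 / c)) {lam..}"
  shows "partition_function \<Omega> = (\<Prod>v<nV \<Omega>. level (degree \<Omega> v) (fn \<Omega> v) 0) * normalized_Z c (vertex_ratio c \<Omega>) (edge_list \<Omega>)"
proof -
  have wf: "wf_inst \<Omega>" and FR: "\<And>v. v < nV \<Omega> \<Longrightarrow> (degree \<Omega> v, fn \<Omega> v) \<in> fibonacci_range c (c / 2) (c + 2 / c)"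
    using \<Omega> by (auto simp: Holant_def)
  let ?f0 = "\<lambda>v. level (degree \<Omega> v) (fn \<Omega> v) 0"
  have val: "fn \<Omega> v (map \<sigma> (incident \<Omega> v)) = ?f0 v * fib_seq c (vertex_ratio c \<Omega> v) (count_at (ends \<Omega>) \<sigma> [0..<nE \<Omega>] v)"
    if v: "v < nV \<Omega>" for v \<sigma>
  proof -
    let ?d = "degree \<Omega> v" and ?F = "fn \<Omega> v" and ?k = "count_at (ends \<Omega>) \<sigma> [0..<nE \<Omega>] v"
    let ?x = "vertex_ratio c \<Omega> v"
    have FRv: "(?d, ?F) \<in> fibonacci c" "\<And>i. i < ?d \<Longrightarrow> c / 2 * level ?d ?F i \<le> level ?d ?F (i + 1)"
      "\<And>i. i < ?d \<Longrightarrow> level ?d ?F (i + 1) \<le> (c + 2 / c) * level ?d ?F i"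
      using FR[OF v] by (auto simp: fibonacci_range_def)
    have sym: "symmetric_fn ?d ?F" and f0: "0 \<le> ?f0 v" using FRv(1) by (auto simp: fibonacci_def)
    have len: "length (map \<sigma> (incident \<Omega> v)) = ?d" by (simp add: degree_def)
    have cnt: "count_list (map \<sigma> (incident \<Omega> v)) True = ?k"
      unfolding incident_def count_at_def count_list_map_filter ..
    have "?k \<le> ?d" unfolding cnt[symmetric] len[symmetric] by (rule count_le_length)
    moreover have "0 < ?d \<Longrightarrow> level ?d ?F 1 = ?x * ?f0 v"
    proof -
      assume d: "0 < ?d"
      show ?thesis
      proof (cases "0 < ?f0 v")
        case False
        then have "?f0 v = 0" using f0 by simp
        then show ?thesis using FRv(2,3)[of 0] d by simp
      qed (simp add: vertex_ratio_def d Let_def)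
    qed
    moreover have "0 < ?x"
    proof (cases "0 < ?d \<and> 0 < ?f0 v")
      case True
      then have "0 < c / 2 * ?f0 v" using c by simp
      also have "\<dots> \<le> level ?d ?F 1" using FRv(2)[of 0] True by simp
      finally show ?thesis using True by (simp add: vertex_ratio_def Let_def)
    qed (use c in \<open>auto simp: vertex_ratio_def Let_def\<close>)
    ultimately have "level ?d ?F ?k = ?f0 v * fib_seq c ?x ?k"
      by (intro fibonacci_level[OF c FRv(1)]) auto
    then show ?thesis using sym len cnt by (simp add: symmetric_fn_def)
  qed
  have "partition_function \<Omega> = (\<Sum>\<sigma>\<in>{..<nE \<Omega>} \<rightarrow>\<^sub>E UNIV. (\<Prod>v<nV \<Omega>. ?f0 v) * ((\<Prod>e<nE \<Omega>. weight \<Omega> e ^ of_bool (\<sigma> e)) *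
      (\<Prod>v<nV \<Omega>. fib_seq c (vertex_ratio c \<Omega> v) (count_at (ends \<Omega>) \<sigma> [0..<nE \<Omega>] v))))"
    unfolding partition_function_def by (intro sum.cong refl) (simp add: val prod.distrib)
  also have "\<dots> = (\<Prod>v<nV \<Omega>. ?f0 v) * normalized_Z c (vertex_ratio c \<Omega>) (edge_list \<Omega>)"
  proof -
    have s: "set [0..<nE \<Omega>] = {..<nE \<Omega>}" by auto
    have "\<forall>e\<in>set [0..<nE \<Omega>]. fst (ends \<Omega> e) < nV \<Omega> \<and> snd (ends \<Omega> e) < nV \<Omega> \<and> fst (ends \<Omega> e) \<noteq> snd (ends \<Omega> e)"
      using wf by (auto simp: wf_inst_def)
    from normalized_Z_eq_sum[OF distinct_upt this, where w = "weight \<Omega>" and c = c and r = "vertex_ratio c \<Omega>"]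
    show ?thesis unfolding s edge_list_def by (simp add: sum_distrib_left[symmetric])
  qed
  finally show ?thesis .
qed

lemma (in fib) admissible_vertex_ratio:
  assumes \<Omega>: "\<Omega> \<in> Holant (fibonacci_range c (c / 2) (c + 2 / c)) {lam..}"
  shows "admissible al (vertex_ratio c \<Omega> v)"
proof (rule admissible_range)
  let ?d = "degree \<Omega> v" and ?F = "fn \<Omega> v"
  \<comment> \<open>The claim covers all indices: those that are not vertices have degree 0 and
    receive the default \<open>c\<close>.\<close>
  have "v < nV \<Omega>" if "0 < ?d"
  proof -
    have "incident \<Omega> v \<noteq> []" using that by (auto simp: degree_def)
    then obtain e where "e \<in> set (incident \<Omega> v)" using hd_in_set by blast
    then show ?thesis using \<Omega> by (auto simp: incident_def Holant_def wf_inst_def)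
  qed
  then have "(?d, ?F) \<in> fibonacci_range c (c / 2) (c + 2 / c)" if "0 < ?d"
    using \<Omega> that by (auto simp: Holant_def)
  then have F: "\<And>i. i < ?d \<Longrightarrow> c / 2 * level ?d ?F i \<le> level ?d ?F (i + 1)"
      "\<And>i. i < ?d \<Longrightarrow> level ?d ?F (i + 1) \<le> (c + 2 / c) * level ?d ?F i"
    unfolding fibonacci_range_def by fastforce+
  have "c / 2 \<le> vertex_ratio c \<Omega> v \<and> vertex_ratio c \<Omega> v \<le> c + 2 / c"
  proof (cases "0 < ?d \<and> 0 < level ?d ?F 0")
    case True
    then have d: "0 < ?d" and p: "0 < level ?d ?F 0" by auto
    have x: "vertex_ratio c \<Omega> v = level ?d ?F 1 / level ?d ?F 0"
      using True by (simp add: vertex_ratio_def Let_def)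
    show ?thesis using F(1,2)[OF d] unfolding x
      by (simp only: add_0 pos_le_divide_eq[OF p] pos_divide_le_eq[OF p])
  qed (use c_pos in \<open>auto simp: vertex_ratio_def Let_def\<close>)
  then show "c / 2 \<le> vertex_ratio c \<Omega> v" "vertex_ratio c \<Omega> v \<le> c + 2 / c" by auto
qed

section \<open>The program\<close>

definition ev :: "program \<Rightarrow> val list \<Rightarrow> expr \<Rightarrow> val \<Rightarrow> nat \<Rightarrow> bool" where
  "ev P env e v T \<longleftrightarrow> (\<exists>t\<le>T. eval P env e v t)"

definition evs :: "program \<Rightarrow> val list \<Rightarrow> expr list \<Rightarrow> val list \<Rightarrow> nat \<Rightarrow> bool" where
  "evs P env es vs T \<longleftrightarrow> (\<exists>t\<le>T. evals P env es vs t)"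

text \<open>Lets the value and the time be assembled from the rules for the subexpressions and
  compared with the claimed ones only at the end.\<close>

lemma ev_mono: "ev P env e v' T' \<Longrightarrow> v' = v \<Longrightarrow> T' \<le> T \<Longrightarrow> ev P env e v T"
  by (auto simp: ev_def intro: order_trans)

lemma ev_Var: "i < length env \<Longrightarrow> ev P env (Var i) (env ! i) 1"
  unfolding ev_def using eval_evals.Var by blast

lemma ev_Vars:
  "ev P (a0 # env) (Var 0) a0 1"
  "ev P (a0 # a1 # env) (Var 1) a1 1"
  "ev P (a0 # a1 # a2 # env) (Var 2) a2 1"
  "ev P (a0 # a1 # a2 # a3 # env) (Var 3) a3 1"
  "ev P (a0 # a1 # a2 # a3 # a4 # env) (Var 4) a4 1"
  "ev P (a0 # a1 # a2 # a3 # a4 # a5 # env) (Var 5) a5 1"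
  "ev P (a0 # a1 # a2 # a3 # a4 # a5 # a6 # env) (Var 6) a6 1"
  "ev P (a0 # a1 # a2 # a3 # a4 # a5 # a6 # a7 # env) (Var 7) a7 1"
  "ev P (a0 # a1 # a2 # a3 # a4 # a5 # a6 # a7 # a8 # env) (Var 8) a8 1"
  using ev_Var[of 0 "a0 # env" P]
    ev_Var[of 1 "a0 # a1 # env" P]
    ev_Var[of 2 "a0 # a1 # a2 # env" P]
    ev_Var[of 3 "a0 # a1 # a2 # a3 # env" P]
    ev_Var[of 4 "a0 # a1 # a2 # a3 # a4 # env" P]
    ev_Var[of 5 "a0 # a1 # a2 # a3 # a4 # a5 # env" P]
    ev_Var[of 6 "a0 # a1 # a2 # a3 # a4 # a5 # a6 # env" P]
    ev_Var[of 7 "a0 # a1 # a2 # a3 # a4 # a5 # a6 # a7 # env" P]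
    ev_Var[of 8 "a0 # a1 # a2 # a3 # a4 # a5 # a6 # a7 # a8 # env" P]
  by simp_all

lemma ev_Lit: "ev P env (Lit r) (RealV (of_rat r)) 1"
  unfolding ev_def using eval_evals.Lit by blast

lemma ev_Arith:
  assumes "ev P env e1 (RealV x) t1" "ev P env e2 (RealV y) t2"
  shows "ev P env (Arith Plus e1 e2) (RealV (x + y)) (t1 + t2 + 1)"
    and "ev P env (Arith Minus e1 e2) (RealV (x - y)) (t1 + t2 + 1)"
    and "ev P env (Arith Times e1 e2) (RealV (x * y)) (t1 + t2 + 1)"
    and "y \<noteq> 0 \<Longrightarrow> ev P env (Arith Divide e1 e2) (RealV (x / y)) (t1 + t2 + 1)"
proof -
  obtain s1 s2 where s: "s1 \<le> t1" "eval P env e1 (RealV x) s1" "s2 \<le> t2" "eval P env e2 (RealV y) s2"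
    using assms by (auto simp: ev_def)
  have "ev P env (Arith oper e1 e2) (RealV (arith_apply oper x y)) (t1 + t2 + 1)"
    if "arith_defined oper y" for oper
    unfolding ev_def using eval_evals.Arith[OF s(2,4) that] s(1,3)
    by (intro exI[of _ "s1 + s2 + 1"]) auto
  from this[of Plus] this[of Minus] this[of Times] this[of Divide]
  show "ev P env (Arith Plus e1 e2) (RealV (x + y)) (t1 + t2 + 1)"
    and "ev P env (Arith Minus e1 e2) (RealV (x - y)) (t1 + t2 + 1)"
    and "ev P env (Arith Times e1 e2) (RealV (x * y)) (t1 + t2 + 1)"
    and "y \<noteq> 0 \<Longrightarrow> ev P env (Arith Divide e1 e2) (RealV (x / y)) (t1 + t2 + 1)" by simp_all
qed

lemma ev_IfLess_True:
  assumes "ev P env e1 (RealV x) t1" "ev P env e2 (RealV y) t2" "x < y" "ev P env e3 v t3"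
  shows "ev P env (IfLess e1 e2 e3 e4) v (t1 + t2 + t3 + 1)"
proof -
  obtain s1 s2 s3 where s: "s1 \<le> t1" "eval P env e1 (RealV x) s1" "s2 \<le> t2" "eval P env e2 (RealV y) s2"
    "s3 \<le> t3" "eval P env e3 v s3"
    using assms by (auto simp: ev_def)
  show ?thesis unfolding ev_def using eval_evals.IfLess_True[OF s(2,4) assms(3) s(6)] s(1,3,5)
    by (intro exI[of _ "s1 + s2 + s3 + 1"]) auto
qed

lemma ev_IfLess_False:
  assumes "ev P env e1 (RealV x) t1" "ev P env e2 (RealV y) t2" "\<not> x < y" "ev P env e4 v t4"
  shows "ev P env (IfLess e1 e2 e3 e4) v (t1 + t2 + t4 + 1)"
proof -
  obtain s1 s2 s3 where s: "s1 \<le> t1" "eval P env e1 (RealV x) s1" "s2 \<le> t2" "eval P env e2 (RealV y) s2"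
    "s3 \<le> t4" "eval P env e4 v s3"
    using assms by (auto simp: ev_def)
  show ?thesis unfolding ev_def using eval_evals.IfLess_False[OF s(2,4) assms(3) s(6)] s(1,3,5)
    by (intro exI[of _ "s1 + s2 + s3 + 1"]) auto
qed

lemma ev_IfPair_True:
  assumes "ev P env e1 (PairV a b) t1" "ev P env e2 v t2"
  shows "ev P env (IfPair e1 e2 e3) v (t1 + t2 + 1)"
proof -
  obtain s1 s2 where s: "s1 \<le> t1" "eval P env e1 (PairV a b) s1" "s2 \<le> t2" "eval P env e2 v s2"
    using assms by (auto simp: ev_def)
  show ?thesis unfolding ev_def using eval_evals.IfPair_True[OF s(2,4)] s(1,3)
    by (intro exI[of _ "s1 + s2 + 1"]) auto
qed

lemma ev_IfPair_False:
  assumes "ev P env e1 (RealV x) t1" "ev P env e3 v t2"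
  shows "ev P env (IfPair e1 e2 e3) v (t1 + t2 + 1)"
proof -
  obtain s1 s2 where s: "s1 \<le> t1" "eval P env e1 (RealV x) s1" "s2 \<le> t2" "eval P env e3 v s2"
    using assms by (auto simp: ev_def)
  show ?thesis unfolding ev_def using eval_evals.IfPair_False[OF s(2,4)] s(1,3)
    by (intro exI[of _ "s1 + s2 + 1"]) auto
qed

lemma ev_MkPair:
  assumes "ev P env e1 a t1" "ev P env e2 b t2"
  shows "ev P env (MkPair e1 e2) (PairV a b) (t1 + t2 + 1)"
proof -
  obtain s1 s2 where s: "s1 \<le> t1" "eval P env e1 a s1" "s2 \<le> t2" "eval P env e2 b s2"
    using assms by (auto simp: ev_def)
  show ?thesis unfolding ev_def using eval_evals.MkPair[OF s(2,4)] s(1,3)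
    by (intro exI[of _ "s1 + s2 + 1"]) auto
qed

lemma ev_First: "ev P env e (PairV a b) t \<Longrightarrow> ev P env (First e) a (t + 1)"
  unfolding ev_def using eval_evals.First by (metis add_le_mono1)

lemma ev_Second: "ev P env e (PairV a b) t \<Longrightarrow> ev P env (Second e) b (t + 1)"
  unfolding ev_def using eval_evals.Second by (metis add_le_mono1)

lemma ev_LetIn:
  assumes "ev P env e1 a t1" "ev P (a # env) e2 v t2"
  shows "ev P env (LetIn e1 e2) v (t1 + t2 + 1)"
proof -
  obtain s1 s2 where s: "s1 \<le> t1" "eval P env e1 a s1" "s2 \<le> t2" "eval P (a # env) e2 v s2"
    using assms by (auto simp: ev_def)
  show ?thesis unfolding ev_def using eval_evals.LetIn[OF s(2,4)] s(1,3)
    by (intro exI[of _ "s1 + s2 + 1"]) auto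
qed

lemma ev_Call:
  assumes "evs P env es vs t1" "f < length P" "ev P vs (P ! f) v t2"
  shows "ev P env (Call f es) v (t1 + t2 + 1)"
proof -
  obtain s1 s2 where s: "s1 \<le> t1" "evals P env es vs s1" "s2 \<le> t2" "eval P vs (P ! f) v s2"
    using assms by (auto simp: ev_def evs_def)
  show ?thesis unfolding ev_def using eval_evals.Call[OF s(2) assms(2) s(4)] s(1,3)
    by (intro exI[of _ "s1 + s2 + 1"]) auto
qed

lemma evs_Nil: "evs P env [] [] 0"
  unfolding evs_def using eval_evals.Empty by blast

lemma evs_Cons:
  assumes "ev P env e v t1" "evs P env es vs t2"
  shows "evs P env (e # es) (v # vs) (t1 + t2 + 1)"
proof -
  obtain s1 s2 where s: "s1 \<le> t1" "eval P env e v s1" "s2 \<le> t2" "evals P env es vs s2"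
    using assms by (auto simp: ev_def evs_def)
  show ?thesis unfolding evs_def using eval_evals.More[OF s(2,4)] s(1,3)
    by (intro exI[of _ "s1 + s2 + 1"]) auto
qed

section \<open>The functions of the program\<close>

definition ratios_body :: expr where
  "ratios_body = IfPair (Var 1)
     (MkPair
       (IfPair (Second (First (Var 1)))
         (IfLess (Lit 0) (First (First (Var 1)))
           (Arith Divide (First (Second (First (Var 1)))) (First (First (Var 1)))) (Var 0))
         (Var 0))
       (Call 1 [Var 0, Second (Var 1)]))
     (Lit 0)"

definition heads_body :: expr where
  "heads_body = IfPair (Var 0)
     (Arith Times (First (First (Var 0))) (Call 2 [Second (Var 0)])) (Lit 1)"

definition length_body :: expr where
  "length_body = IfPair (Var 0) (Arith Plus (Lit 1) (Call 3 [Second (Var 0)])) (Lit 0)"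

definition approx_Z_body :: expr where
  "approx_Z_body = IfPair (Var 3)
     (LetIn (First (Var 3))
       (Arith Times
         (Arith Plus (Lit 1)
           (Arith Times
             (Arith Times (Second (Var 0))
               (Call 8 [Var 1, Var 2, Var 3, First (First (Var 0)), Second (Var 4)]))
             (Call 8 [Var 1, Var 2, Call 5 [Var 1, Var 3, First (First (Var 0))],
                Second (First (Var 0)), Second (Var 4)])))
         (Call 4 [Var 1, Var 2, Var 3, Second (Var 4)])))
     (Lit 1)"

definition shift_body :: expr where
  "shift_body = IfPair (Var 1)
     (IfLess (Var 2) (Lit 1)
       (MkPair (Arith Plus (Var 0) (Arith Divide (Lit 1) (First (Var 1)))) (Second (Var 1)))
       (MkPair (First (Var 1)) (Call 5 [Var 0, Second (Var 1), Arith Minus (Var 2) (Lit 1)])))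
     (Lit 0)"

definition nth_body :: expr where
  "nth_body = IfPair (Var 0)
     (IfLess (Var 1) (Lit 1) (First (Var 0))
       (Call 6 [Second (Var 0), Arith Minus (Var 1) (Lit 1)]))
     (Lit 0)"

text \<open>Vertex numbers are stored as reals, for which only \<open><\<close> is available.
  Equality is tested by two comparisons, so both operands may be evaluated twice.\<close>

definition if_equal :: "expr \<Rightarrow> expr \<Rightarrow> expr \<Rightarrow> expr \<Rightarrow> expr" where
  "if_equal e1 e2 e3 e4 = IfLess e1 e2 e4 (IfLess e2 e1 e4 e3)"

definition pick_body :: expr where
  "pick_body = IfPair (Var 1)
     (LetIn (First (Var 1))
       (if_equal (First (First (Var 0))) (Var 1)
         (MkPair (MkPair (Second (First (Var 0))) (Second (Var 0))) (Second (Var 2)))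
         (if_equal (Second (First (Var 0))) (Var 1)
           (MkPair (MkPair (First (First (Var 0))) (Second (Var 0))) (Second (Var 2)))
           (LetIn (Call 7 [Var 1, Second (Var 2)])
             (IfPair (Var 0) (MkPair (First (Var 0)) (MkPair (Var 1) (Second (Var 0)))) (Lit 0))))))
     (Lit 0)"

text \<open>The arguments are c, the depth, the ratios, the vertex and the edges. The bindings hold,
  in this order, the result of picking, u, the depth minus one, R0, R1, q and l q (c R0 + 1); each
  one raises the indices of all earlier variables by one.\<close>

definition approx_body :: expr where
  "approx_body = IfLess (Var 1) (Lit 1) (Call 6 [Var 2, Var 3])
     (LetIn (Call 7 [Var 3, Var 4])
       (IfPair (Var 0)
         (LetIn (First (First (Var 0)))
         (LetIn (Arith Minus (Var 3) (Lit 1))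
         (LetIn (Call 8 [Var 3, Var 0, Var 5, Var 6, Second (Var 2)])
         (LetIn (Call 8 [Var 4, Var 1, Call 5 [Var 4, Var 6, Var 2], Var 7, Second (Var 3)])
         (LetIn (Call 8 [Var 5, Var 2, Call 5 [Var 5, Call 5 [Var 5, Var 7, Var 8], Var 8], Var 3,
                   Second (Var 4)])
         (LetIn (Arith Times (Arith Times (Second (First (Var 5))) (Var 0))
                  (Arith Plus (Arith Times (Var 6) (Var 2)) (Lit 1)))
           (Arith Divide (Arith Plus (Var 3) (Var 0))
             (Arith Plus (Lit 1)
               (Arith Divide (Arith Times (Var 0) (Var 2))
                 (Arith Plus (Arith Times (Var 7) (Var 2)) (Lit 1)))))))))))
         (Call 6 [Var 3, Var 4])))"

text \<open>A logarithm to base 1/kap by counting: the least L with x kap^L < 1.\<close>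

definition depth_body :: "rat \<Rightarrow> expr" where
  "depth_body kap = IfLess (Var 0) (Lit 1) (Lit 0)
     (Arith Plus (Lit 1) (Call 9 [Arith Times (Var 0) (Lit kap)]))"

text \<open>The argument of the depth function is 28 (1 + m)(1 + 1/\<epsilon>), since the total
  error 14 kap^L m has to be at most 1/(2 (1 + 1/\<epsilon>)).\<close>

definition main_body :: expr where
  "main_body =
     LetIn (Call 1 [Var 0, First (Var 2)])
     (LetIn (Call 9 [Arith Times (Arith Times (Lit 28) (Arith Plus (Lit 1) (Call 3 [Second (Var 3)])))
                 (Arith Plus (Lit 1) (Arith Divide (Lit 1) (Var 4)))])
       (Arith Times (Call 2 [First (Var 4)]) (Call 4 [Var 2, Var 0, Var 1, Second (Var 4)])))"

definition prog :: "rat \<Rightarrow> program" where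
  "prog kap = [main_body, ratios_body, heads_body, length_body, approx_Z_body, shift_body, nth_body,
     pick_body, approx_body, depth_body kap]"

lemma ev_Calls:
  assumes "evs (prog k) env es vs t1"
  shows "ev (prog k) vs ratios_body v t2 \<Longrightarrow> ev (prog k) env (Call 1 es) v (t1 + t2 + 1)"
    and "ev (prog k) vs heads_body v t2 \<Longrightarrow> ev (prog k) env (Call 2 es) v (t1 + t2 + 1)"
    and "ev (prog k) vs length_body v t2 \<Longrightarrow> ev (prog k) env (Call 3 es) v (t1 + t2 + 1)"
    and "ev (prog k) vs approx_Z_body v t2 \<Longrightarrow> ev (prog k) env (Call 4 es) v (t1 + t2 + 1)"
    and "ev (prog k) vs shift_body v t2 \<Longrightarrow> ev (prog k) env (Call 5 es) v (t1 + t2 + 1)"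
    and "ev (prog k) vs nth_body v t2 \<Longrightarrow> ev (prog k) env (Call 6 es) v (t1 + t2 + 1)"
    and "ev (prog k) vs pick_body v t2 \<Longrightarrow> ev (prog k) env (Call 7 es) v (t1 + t2 + 1)"
    and "ev (prog k) vs approx_body v t2 \<Longrightarrow> ev (prog k) env (Call 8 es) v (t1 + t2 + 1)"
    and "ev (prog k) vs (depth_body k) v t2 \<Longrightarrow> ev (prog k) env (Call 9 es) v (t1 + t2 + 1)"
  by (rule ev_Call[OF assms]; simp add: prog_def)+

lemmas ev_rules = ev_Vars ev_Lit ev_Arith ev_MkPair ev_First ev_Second ev_LetIn ev_Calls evs_Nil evs_Cons

section \<open>Encodings and the correctness of the subroutines\<close>

definition enc_reals :: "real list \<Rightarrow> val" where "enc_reals xs = list_val (map RealV xs)"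

fun enc_edge :: "edge \<Rightarrow> val" where
  "enc_edge (s, t, l) = PairV (PairV (RealV (real s)) (RealV (real t))) (RealV l)"

definition enc_edges :: "edge list \<Rightarrow> val" where "enc_edges E = list_val (map enc_edge E)"

lemma enc_simps [simp]:
  "enc_reals [] = RealV 0" "enc_reals (x # xs) = PairV (RealV x) (enc_reals xs)"
  "enc_edges [] = RealV 0" "enc_edges ((s, t, l) # E) =
     PairV (PairV (PairV (RealV (real s)) (RealV (real t))) (RealV l)) (enc_edges E)"
  by (simp_all add: enc_reals_def enc_edges_def)

lemma ev_if_equal_True:
  assumes "ev P env e1 (RealV x) t1" "ev P env e2 (RealV y) t2" "x = y" "ev P env e3 v t3"
  shows "ev P env (if_equal e1 e2 e3 e4) v (2 * t1 + 2 * t2 + t3 + 2)"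
  unfolding if_equal_def
  by (rule ev_mono, rule ev_IfLess_False[OF assms(1,2) _ ev_IfLess_False[OF assms(2,1) _ assms(4)]])
    (use assms(3) in auto)

lemma ev_if_equal_False:
  assumes "ev P env e1 (RealV x) t1" "ev P env e2 (RealV y) t2" "x \<noteq> y" "ev P env e4 v t4"
  shows "ev P env (if_equal e1 e2 e3 e4) v (2 * t1 + 2 * t2 + t4 + 2)"
proof (cases "x < y")
  case True
  show ?thesis unfolding if_equal_def
    by (rule ev_mono, rule ev_IfLess_True[OF assms(1,2) True assms(4)]) auto
next
  case False
  then have "y < x" using assms(3) by simp
  then show ?thesis unfolding if_equal_def
    by (intro ev_mono[OF ev_IfLess_False[OF assms(1,2) False ev_IfLess_True[OF assms(2,1) _ assms(4)]]]) auto
qed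

lemma ev_nth:
  assumes "u < length xs" "y = real u"
  shows "ev (prog k) [enc_reals xs, RealV y] nth_body (RealV (xs ! u)) (20 * length xs)"
  using assms
proof (induction xs arbitrary: u y)
  case (Cons x xs)
  show ?case
  proof (cases u)
    case 0
    show ?thesis unfolding nth_body_def enc_simps
      by (rule ev_mono, (rule ev_rules ev_IfPair_True ev_IfLess_True | (simp add: 0 Cons.prems; fail))+)
  next
    case (Suc m)
    have m: "m < length xs" "y - of_rat 1 = real m" using Cons.prems Suc by auto
    show ?thesis unfolding nth_body_def enc_simps
      by (rule ev_mono, (rule ev_rules ev_IfPair_True ev_IfLess_False Cons.IH[OF m, unfolded nth_body_def]
          Cons.IH[OF m] | (simp add: Suc Cons.prems; fail))+)
  qed
qed simp

lemma ev_shift: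
  assumes "u < length xs" "y = real u" "xs ! u \<noteq> 0"
  shows "ev (prog k) [RealV c, enc_reals xs, RealV y] shift_body (enc_reals (xs[u := shift c (xs ! u)])) (30 * length xs)"
  using assms
proof (induction xs arbitrary: u y)
  case (Cons x xs)
  show ?case
  proof (cases u)
    case 0
    show ?thesis unfolding shift_body_def enc_simps
      by (rule ev_mono, (rule ev_rules ev_IfPair_True ev_IfLess_True
        | (use Cons.prems in \<open>simp add: 0 shift_def\<close>; fail))+)
  next
    case (Suc m)
    have m: "m < length xs" "y - of_rat 1 = real m" "xs ! m \<noteq> 0" using Cons.prems Suc by auto
    show ?thesis unfolding shift_body_def enc_simps
      by (rule ev_mono, (rule ev_rules ev_IfPair_True ev_IfLess_False
          Cons.IH[OF m] | (simp add: Suc Cons.prems; fail))+)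
  qed
qed simp


fun enc_pick :: "((nat \<times> real) \<times> edge list) option \<Rightarrow> val" where
  "enc_pick None = RealV 0"
| "enc_pick (Some ((u, l), E)) = PairV (PairV (RealV (real u)) (RealV l)) (enc_edges E)"

lemma ev_pick:
  "ev (prog k) [RealV (real v), enc_edges E] pick_body (enc_pick (pick v E)) (60 * (length E + 1))"
proof (induction E)
  case Nil
  show ?case unfolding pick_body_def enc_simps
    by (rule ev_mono, (rule ev_rules ev_IfPair_False | (simp; fail))+)
next
  case (Cons e E)
  obtain s t l where e: "e = (s, t, l)" by (cases e) auto
  consider "s = v" | "s \<noteq> v" "t = v" | "s \<noteq> v" "t \<noteq> v" by blast
  then show ?case
  proof cases
    case 1
    show ?thesis unfolding pick_body_def e enc_simps
      by (rule ev_mono, (rule ev_rules ev_IfPair_True ev_if_equal_True | (simp add: 1; fail))+)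
  next
    case 2
    show ?thesis unfolding pick_body_def e enc_simps
      by (rule ev_mono, rule ev_IfPair_True, (rule ev_rules)+, rule ev_if_equal_False,
        (rule ev_rules ev_if_equal_True | (use 2 in \<open>simp\<close>; fail))+)
  next
    case 3
    show ?thesis
    proof (cases "pick v E")
      case None
      note C = Cons.IH[unfolded None enc_pick.simps]
      show ?thesis unfolding pick_body_def e enc_simps
        by (rule ev_mono, rule ev_IfPair_True, (rule ev_rules)+, rule ev_if_equal_False,
          (rule ev_rules C ev_if_equal_False ev_IfPair_False | (use 3 None in \<open>simp\<close>; fail))+)
    next
      case (Some a)
      obtain u m E' where a: "a = ((u, m), E')" by (metis surj_pair)
      note C = Cons.IH[unfolded Some a enc_pick.simps]
      show ?thesis unfolding pick_body_def e enc_simps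
        by (rule ev_mono, rule ev_IfPair_True, (rule ev_rules)+, rule ev_if_equal_False,
          (rule ev_rules C ev_if_equal_False ev_IfPair_True | (use 3 Some a in \<open>simp\<close>; fail))+)
    qed
  qed
qed

lemma ev_length: "ev (prog k) [enc_edges E] length_body (RealV (real (length E))) (20 * (length E + 1))"
proof (induction E)
  case Nil
  show ?case unfolding length_body_def enc_simps
    by (rule ev_mono, (rule ev_rules ev_IfPair_False | (simp; fail))+)
next
  case (Cons e E)
  obtain s t l where e: "e = (s, t, l)" by (cases e) auto
  show ?case unfolding length_body_def e enc_simps
    by (rule ev_mono, (rule ev_rules ev_IfPair_True Cons.IH | (simp; fail))+)
qed

lemma ev_heads:
  assumes "\<forall>x\<in>set xs. x \<noteq> []"
  shows "ev (prog k) [list_val (map enc_reals xs)] heads_body (RealV (prod_list (map hd xs))) (20 * (length xs + 1))"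
  using assms
proof (induction xs)
  case Nil
  show ?case unfolding heads_body_def list.map list_val.simps
    by (rule ev_mono, (rule ev_rules ev_IfPair_False | (simp; fail))+)
next
  case (Cons x xs)
  have IH: "ev (prog k) [list_val (map enc_reals xs)] heads_body (RealV (prod_list (map hd xs))) (20 * (length xs + 1))"
    using Cons by simp
  obtain a x' where x: "x = a # x'" using Cons.prems by (cases x) auto
  show ?case unfolding heads_body_def x list.map list_val.simps enc_simps
    by (rule ev_mono, (rule ev_rules ev_IfPair_True IH | (simp; fail))+)
qed

definition ratio :: "real \<Rightarrow> real list \<Rightarrow> real" where
  "ratio c f = (if 1 < length f \<and> 0 < f ! 0 then f ! 1 / f ! 0 else c)"

lemma ev_ratios:
  assumes "\<forall>x\<in>set xs. x \<noteq> []"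
  shows "ev (prog k) [RealV c, list_val (map enc_reals xs)] ratios_body (enc_reals (map (ratio c) xs)) (40 * (length xs + 1))"
  using assms
proof (induction xs)
  case Nil
  show ?case unfolding ratios_body_def list.map list_val.simps enc_simps
    by (rule ev_mono, (rule ev_rules ev_IfPair_False | (simp; fail))+)
next
  case (Cons x xs)
  have IH: "ev (prog k) [RealV c, list_val (map enc_reals xs)] ratios_body (enc_reals (map (ratio c) xs)) (40 * (length xs + 1))"
    using Cons by simp
  obtain a x' where x: "x = a # x'" using Cons.prems by (cases x) auto
  show ?case
  proof (cases x')
    case Nil
    show ?thesis unfolding ratios_body_def x Nil list.map list_val.simps enc_simps
      by (rule ev_mono, rule ev_IfPair_True, (rule ev_rules ev_IfPair_False IH | (simp add: ratio_def; fail))+)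
  next
    case (Cons a' x'')
    show ?thesis
    proof (cases "0 < a")
      case True
      show ?thesis unfolding ratios_body_def x Cons list.map list_val.simps enc_simps
        by (rule ev_mono, (rule ev_rules ev_IfPair_True ev_IfLess_True IH | (use True in \<open>simp add: ratio_def\<close>; fail))+)
    next
      case False
      show ?thesis unfolding ratios_body_def x Cons list.map list_val.simps enc_simps
        by (rule ev_mono, (rule ev_rules ev_IfPair_True ev_IfLess_False IH | (use False in \<open>simp add: ratio_def\<close>; fail))+)
    qed
  qed
qed

text \<open>The exponent \<open>n\<close> only witnesses termination. The last conjunct says that L
  is not larger than necessary, and the polynomial bound on 4^L rests on it.\<close>

lemma ev_depth:
  assumes "0 < of_rat k * (1 :: real)" "x * of_rat k ^ n < 1"
  shows "\<exists>L. ev (prog k) [RealV x] (depth_body k) (RealV (real L)) (20 * (L + 1)) \<and> x * of_rat k ^ L < 1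
     \<and> (L = 0 \<or> 1 \<le> x * of_rat k ^ (L - 1))"
  using assms(2)
proof (induction n arbitrary: x)
  case 0
  have "ev (prog k) [RealV x] (depth_body k) (RealV (real 0)) (20 * (0 + 1))"
    unfolding depth_body_def
    by (rule ev_mono, (rule ev_rules ev_IfLess_True | (use 0 in simp; fail))+)
  then show ?case using 0 by (intro exI[of _ 0]) auto
next
  case (Suc n)
  show ?case
  proof (cases "x < 1")
    case True
    have "ev (prog k) [RealV x] (depth_body k) (RealV (real 0)) (20 * (0 + 1))"
      unfolding depth_body_def
      by (rule ev_mono, (rule ev_rules ev_IfLess_True | (use True in simp; fail))+)
    then show ?thesis using True by (intro exI[of _ 0]) auto
  next
    case False
    have "x * of_rat k * of_rat k ^ n < 1" using Suc.prems by (simp add: mult_ac)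
    from Suc.IH[OF this] obtain L where L: "ev (prog k) [RealV (x * of_rat k)] (depth_body k) (RealV (real L)) (20 * (L + 1))"
      "x * of_rat k * of_rat k ^ L < 1" "L = 0 \<or> 1 \<le> x * of_rat k * of_rat k ^ (L - 1)" by blast
    have "ev (prog k) [RealV x] (depth_body k) (RealV (real (Suc L))) (20 * (Suc L + 1))"
      unfolding depth_body_def
      by (rule ev_mono, (rule ev_rules ev_IfLess_False L(1) | (use False in simp; fail))+)
    moreover have "1 \<le> x * of_rat k ^ (Suc L - 1)"
      using L(3) False by (cases L) (auto simp: mult_ac)
    ultimately show ?thesis using L(2) by (intro exI[of _ "Suc L"]) (auto simp: mult_ac)
  qed
qed

definition enc_fun :: "nat \<Rightarrow> (nat \<Rightarrow> real) \<Rightarrow> val" where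
  "enc_fun n r = enc_reals (map r [0..<n])"

lemma ev_nth_fun:
  assumes "u < n"
  shows "ev (prog k) [enc_fun n r, RealV (real u)] nth_body (RealV (r u)) (20 * n)"
  using ev_nth[of u "map r [0..<n]" "real u" k] assms by (simp add: enc_fun_def)

lemma ev_shift_fun:
  assumes "u < n" "r u \<noteq> 0"
  shows "ev (prog k) [RealV c, enc_fun n r, RealV (real u)] shift_body (enc_fun n (r(u := shift c (r u)))) (30 * n)"
proof -
  have "(map r [0..<n])[u := x] = map (r(u := x)) [0..<n]" for x
    by (rule nth_equalityI) (auto simp: nth_list_update)
  then show ?thesis using ev_shift[of u "map r [0..<n]" "real u" k c] assms by (simp add: enc_fun_def)
qed

lemma combine_pos:
  assumes "0 < c" "0 < l" "0 < R0" "0 < R1" "0 < q"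
  shows "0 < combine c l R0 R1 q"
  unfolding combine_def using assms by (intro divide_pos_pos add_pos_pos mult_pos_pos) auto

text \<open>Needed for definedness: with positive arguments no divisor in \<open>combine\<close> or
  \<open>shift\<close> vanishes.\<close>

lemma approx_pos:
  assumes "0 < c" "\<And>w. 0 < r w" "\<forall>e\<in>set E. edge_ok e"
  shows "0 < approx c L r v E"
  using assms(2,3)
proof (induction L arbitrary: r v E)
  case (Suc L)
  show ?case
  proof (cases "pick v E")
    case None
    then show ?thesis using Suc.prems(1) by simp
  next
    case (Some a)
    obtain u l E' where p: "pick v E = Some ((u, l), E')" using Some by (cases a) auto
    have ok': "\<forall>e\<in>set E'. edge_ok e" using pick_Some(2)[OF p] Suc.prems(2) by auto
    have l: "l > 0" using pick_Some(3)[OF p] Suc.prems(2) by (auto simp: edge_ok_def)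
    have "0 < combine c l (approx c L r v E') (approx c L (r(u := shift c (r u))) v E')
         (approx c L (r(v := shift c (shift c (r v)))) u E')"
      by (intro combine_pos assms(1) l Suc.IH ok') (simp_all add: Suc.prems(1) shift_pos assms(1))
    then show ?thesis using p by simp
  qed
qed simp

definition edge_in :: "nat \<Rightarrow> edge \<Rightarrow> bool" where
  "edge_in n e \<longleftrightarrow> edge_ok e \<and> fst e < n \<and> fst (snd e) < n"

text \<open>There are three recursive calls per level. The base 4 instead of 3 leaves a fourth
  share, 600 (N + 1) 4^L, for the linear cost of picking an edge and updating the ratios.\<close>

lemma ev_approx:
  assumes c: "0 < c" and "\<And>w. 0 < r w" "\<forall>e\<in>set E. edge_in n e" "length E \<le> N" "n \<le> N" "v < n" "y = real L"
  shows "ev (prog k) [RealV c, RealV y, enc_fun n r, RealV (real v), enc_edges E] approx_body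
    (RealV (approx c L r v E)) (600 * (N + 1) * 4 ^ L)"
  using assms(2-)
proof (induction L arbitrary: r v E y)
  case 0
  note C = ev_nth_fun[OF 0(5), where r = r and k = k]
  show ?case unfolding approx_body_def
    by (rule ev_mono, (rule ev_rules ev_IfLess_True C | (use 0 in simp; fail))+)
next
  case (Suc L)
  have p1: "(1::nat) \<le> 4 ^ L" by simp
  define X where "X = (N + 1) * 4 ^ L"
  have X: "N + 1 \<le> X" unfolding X_def using mult_le_mono2[OF p1, of "N + 1"] by simp
  have T: "600 * (N + 1) * 4 ^ L = 600 * X" "600 * (N + 1) * 4 ^ Suc L = 2400 * X"
    unfolding X_def by (simp_all add: algebra_simps)
  note pk = ev_pick[where v = v and E = E and k = k]
  note C = ev_nth_fun[OF Suc.prems(5), where r = r and k = k]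
  show ?case
  proof (cases "pick v E")
    case None
    show ?thesis unfolding approx_body_def T
      by (rule ev_mono, (rule ev_rules ev_IfLess_False ev_IfPair_False C pk[unfolded None enc_pick.simps]
        | (use Suc.prems None X in simp; fail))+)
  next
    case (Some a)
    obtain u l E' where p: "pick v E = Some ((u, l), E')" using Some by (cases a) auto
    have in': "\<forall>e\<in>set E'. edge_in n e" and ok': "\<forall>e\<in>set E'. edge_ok e"
      using pick_Some(2)[OF p] Suc.prems(2) by (auto simp: edge_in_def)
    have l: "l > 0" and u: "u < n" using pick_Some(3)[OF p] Suc.prems(2) by (auto simp: edge_in_def edge_ok_def)
    have len: "length E' \<le> N" using pick_Some(1)[OF p] Suc.prems(3) by simp
    let ?r1 = "r(u := shift c (r u))" and ?ru = "r(v := shift c (shift c (r v)))"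
    have rp: "0 < r w" "0 < ?r1 w" "0 < ?ru w" for w using Suc.prems(1) by (auto simp: shift_pos c)
    have y: "y - of_rat 1 = real L" using Suc.prems(6) by simp
    have rn: "r w \<noteq> 0" for w using rp(1)[of w] by simp
    note S1 = ev_shift_fun[of u n r, OF u rn, where c = c and k = k]
    note S2 = ev_shift_fun[of v n r, OF Suc.prems(5) rn, where c = c and k = k]
    have S3: "ev (prog k) [RealV c, enc_fun n (r(v := shift c (r v))), RealV (real v)] shift_body
        (enc_fun n ?ru) (30 * n)"
      using ev_shift_fun[OF Suc.prems(5), of "r(v := shift c (r v))" k c] shift_pos[OF c rp(1)[of v]] by simp
    define R0 R1 q where "R0 = approx c L r v E'" and "R1 = approx c L ?r1 v E'" and "q = approx c L ?ru u E'"
    let ?call = "\<lambda>r w R. ev (prog k) [RealV c, RealV (y - of_rat 1), enc_fun n r, RealV (real w), enc_edges E']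
        approx_body (RealV R) (600 * X)"
    have IH: "?call r v R0" "?call ?r1 v R1" "?call ?ru u q"
      unfolding R0_def R1_def q_def T(1)[symmetric]
      by (rule Suc.IH[OF rp(1) in' len Suc.prems(4,5) y], rule Suc.IH[OF rp(2) in' len Suc.prems(4,5) y],
        rule Suc.IH[OF rp(3) in' len Suc.prems(4) u y])
    have pos: "0 < R0" "0 < R1" "0 < q" unfolding R0_def R1_def q_def
      by (intro approx_pos c ok' rp)+
    have res: "approx c (Suc L) r v E = combine c l R0 R1 q"
      using p by (simp add: R0_def R1_def q_def)
    have "c * R1 + 1 > 0" using c pos by (simp add: add_pos_pos)
    then have d1: "c * R1 + of_rat 1 \<noteq> 0" by simp
    have "1 + l * q * (c * R0 + 1) * R1 / (c * R1 + 1) > 0"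
      using c pos l by (intro add_pos_pos divide_pos_pos mult_pos_pos) auto
    then have d2: "of_rat 1 + l * q * (c * R0 + of_rat 1) * R1 / (c * R1 + of_rat 1) \<noteq> 0" by simp
    have bnd: "length E \<le> X" "n \<le> X" "1 \<le> X" using Suc.prems(3,4) X by simp_all
    show ?thesis unfolding approx_body_def T res
      by (rule ev_mono, (rule ev_rules ev_IfLess_False ev_IfPair_True pk[unfolded p enc_pick.simps] S1 S2 S3
          IH d1 d2
        | (use Suc.prems in \<open>simp add: combine_def\<close>; fail)
        | (use bnd in \<open>simp; fail\<close>))+)
  qed
qed

lemma ev_approx_Z:
  assumes c: "0 < c" and r: "\<And>w. 0 < r w" and "\<forall>e\<in>set E. edge_in n e" "length E \<le> N" and n: "n \<le> N"
  shows "ev (prog k) [RealV c, RealV (real L), enc_fun n r, enc_edges E] approx_Z_body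
    (RealV (approx_Z c L r E)) (2000 * (N + 1) * 4 ^ L * (length E + 1))"
  using assms(3,4)
proof (induction E)
  case Nil
  have "2000 * 1 * 1 \<le> 2000 * (N + 1) * 4 ^ L * (length ([] :: edge list) + 1)"
    by (intro mult_le_mono) auto
  then show ?case unfolding approx_Z_body_def enc_simps
    by (intro ev_mono[OF ev_IfPair_False[OF ev_Vars(4) ev_Lit]]) simp_all
next
  case (Cons e E)
  obtain u v l where e: "e = (u, v, l)" by (cases e) auto
  have uv: "u < n" "v < n" using Cons.prems e by (auto simp: edge_in_def)
  have ok: "\<forall>e\<in>set E. edge_in n e" and len: "length E \<le> N" using Cons.prems by auto
  have p1: "(1::nat) \<le> 4 ^ L" by simp
  define X where "X = (N + 1) * 4 ^ L"
  have X: "N + 1 \<le> X" unfolding X_def using mult_le_mono2[OF p1, of "N + 1"] by simp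
  have T: "600 * (N + 1) * 4 ^ L = 600 * X" "2000 * (N + 1) * 4 ^ L * m = 2000 * X * m" for m
    unfolding X_def by (simp_all add: algebra_simps)
  have r1: "0 < (r(u := shift c (r u))) w" for w using r by (auto simp: shift_pos c)
  have rn: "r u \<noteq> 0" using r[of u] by simp
  let ?r1 = "r(u := shift c (r u))"
  have A: "ev (prog k) [RealV c, RealV (real L), enc_fun n r, RealV (real u), enc_edges E]
      approx_body (RealV (approx c L r u E)) (600 * X)"
    unfolding T(1)[symmetric] by (rule ev_approx[OF c r ok len n uv(1) refl])
  have B: "ev (prog k) [RealV c, RealV (real L), enc_fun n ?r1, RealV (real v), enc_edges E]
      approx_body (RealV (approx c L ?r1 v E)) (600 * X)"
    unfolding T(1)[symmetric] by (rule ev_approx[OF c r1 ok len n uv(2) refl])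
  note S = ev_shift_fun[of u n r, OF uv(1) rn, where k = k and c = c]
  show ?case unfolding approx_Z_body_def e enc_simps T
    by (rule ev_mono, (rule ev_rules ev_IfPair_True S A B Cons.IH[OF ok len, unfolded T]
      | (use X n in \<open>simp add: algebra_simps\<close>; fail))+)
qed

section \<open>Accuracy and running time\<close>

lemma encode_vertices:
  "map (encode_vertex \<Omega>) [0..<nV \<Omega>] = map enc_reals (map (\<lambda>v. map (level (degree \<Omega> v) (fn \<Omega> v)) [0..<degree \<Omega> v + 1]) [0..<nV \<Omega>])"
  by (simp add: encode_vertex_def[abs_def] enc_reals_def comp_def)

lemma encode_edges: "list_val (map (encode_edge \<Omega>) [0..<nE \<Omega>]) = enc_edges (edge_list \<Omega>)"
  by (simp add: enc_edges_def edge_list_def encode_edge_def[abs_def] comp_def)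

lemma ratio_levels:
  "ratio c (map (level (degree \<Omega> v) (fn \<Omega> v)) [0..<degree \<Omega> v + 1]) = vertex_ratio c \<Omega> v"
proof -
  have "map f [0..<d + 1] ! i = f i" if "i \<le> d" for f :: "nat \<Rightarrow> real" and d i
    using that by (simp del: upt_Suc)
  then show ?thesis by (simp add: ratio_def vertex_ratio_def Let_def del: upt_Suc)
qed

lemma prod_list_upt: "prod_list (map f [0..<n]) = (\<Prod>i<n. f i)" for f :: "nat \<Rightarrow> real"
  by (induction n) (simp_all add: lessThan_Suc mult.commute)

lemma ev_main:
  fixes \<Omega> :: holant_inst
  defines "m \<equiv> nE \<Omega>" and "N \<equiv> inst_size \<Omega>"
  assumes c: "0 < c" and r: "\<And>v. 0 < vertex_ratio c \<Omega> v" and E: "\<forall>e\<in>set (edge_list \<Omega>). edge_in (nV \<Omega>) e"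
    and eps: "\<epsilon> \<noteq> 0"
    and D: "ev (prog k) [RealV (28 * (1 + real m) * (1 + 1 / \<epsilon>))] (depth_body k) (RealV (real L)) (20 * (L + 1))"
  shows "ev (prog k) [RealV c, RealV lam, encode \<Omega>, RealV \<epsilon>] main_body
    (RealV ((\<Prod>v<nV \<Omega>. level (degree \<Omega> v) (fn \<Omega> v) 0) * approx_Z c L (vertex_ratio c \<Omega>) (edge_list \<Omega>)))
    (2500 * (N + 1) ^ 2 * 4 ^ L)"
proof -
  define vs where "vs = map (\<lambda>v. map (level (degree \<Omega> v) (fn \<Omega> v)) [0..<degree \<Omega> v + 1]) [0..<nV \<Omega>]"
  have enc: "encode \<Omega> = PairV (list_val (map enc_reals vs)) (enc_edges (edge_list \<Omega>))"
    unfolding encode_def encode_vertices encode_edges vs_def ..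
  have vs: "\<forall>x\<in>set vs. x \<noteq> []" and lv: "length vs = nV \<Omega>" by (auto simp: vs_def)
  have lE: "length (edge_list \<Omega>) = m" by (simp add: edge_list_def m_def)
  have R: "enc_reals (map (ratio c) vs) = enc_fun (nV \<Omega>) (vertex_ratio c \<Omega>)"
    unfolding enc_fun_def vs_def by (simp only: map_map comp_def ratio_levels)
  have H: "prod_list (map hd vs) = (\<Prod>v<nV \<Omega>. level (degree \<Omega> v) (fn \<Omega> v) 0)"
  proof -
    have "hd (map f [0..<d + 1]) = f 0" for f :: "nat \<Rightarrow> real" and d by (simp add: hd_map hd_upt del: upt_Suc)
    then show ?thesis unfolding vs_def by (simp only: map_map comp_def prod_list_upt)
  qed
  note ratios = ev_ratios[OF vs, where c = c and k = k, unfolded R lv]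
  note heads = ev_heads[OF vs, where k = k, unfolded H lv]
  note len = ev_length[where k = k and E = "edge_list \<Omega>", unfolded lE]
  have D': "ev (prog k) [RealV (of_rat 28 * (of_rat 1 + real m) * (of_rat 1 + of_rat 1 / \<epsilon>))] (depth_body k)
      (RealV (real L)) (20 * (L + 1))" using D by simp
  have le: "length (edge_list \<Omega>) \<le> N" "nV \<Omega> \<le> N" unfolding lE by (simp_all add: N_def inst_size_def m_def)
  define Y where "Y = (N + 1) ^ 2 * 4 ^ L"
  have p4: "1 \<le> (4::nat) ^ L" by simp
  have Y1: "(N + 1) * (N + 1) * 1 \<le> Y" unfolding Y_def power2_eq_square by (intro mult_le_mono p4) auto
  have Y2: "(N + 1) * 4 ^ L * (m + 1) \<le> Y"
  proof -
    have "(N + 1) * 4 ^ L * (m + 1) \<le> (N + 1) * 4 ^ L * (N + 1)" using le lE by (intro mult_le_mono) auto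
    also have "\<dots> = Y" by (simp add: Y_def power2_eq_square algebra_simps)
    finally show ?thesis .
  qed
  have Y3: "L + 1 \<le> Y"
  proof -
    have "L + 1 \<le> 4 ^ L" by (induction L) auto
    also have "1 * 4 ^ L \<le> Y" unfolding Y_def by (intro mult_le_mono) auto
    finally show ?thesis by simp
  qed
  have Y4: "N + 1 \<le> Y" using Y1 by simp
  have bnd: "nV \<Omega> + 1 \<le> Y" "m + 1 \<le> Y" using Y4 le lE by auto
  have Wt: "ev (prog k) [RealV c, RealV (real L), enc_fun (nV \<Omega>) (vertex_ratio c \<Omega>), enc_edges (edge_list \<Omega>)]
      approx_Z_body (RealV (approx_Z c L (vertex_ratio c \<Omega>) (edge_list \<Omega>))) (2000 * Y)"
    by (rule ev_mono[OF ev_approx_Z[OF c r E le] refl])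
      (use mult_le_mono2[OF Y2, of 2000] in \<open>simp only: lE mult.assoc\<close>)
  have T: "2500 * (N + 1) ^ 2 * 4 ^ L = 2500 * Y" by (simp add: Y_def)
  have eps': "\<epsilon> \<noteq> 0" by (rule eps)
  show ?thesis unfolding main_body_def enc T
    by (rule ev_mono, ((rule ev_rules ratios heads len D' Wt eps')+)[1], rule refl)
      (use bnd Y3 in simp)
qed

section \<open>From logarithmic error to the approximation guarantee\<close>

lemma exp_le_one_plus_double: "0 \<le> x \<Longrightarrow> x \<le> 1 \<Longrightarrow> exp x \<le> 1 + 2 * x" for x :: real
proof -
  assume x: "0 \<le> x" "x \<le> 1"
  have "x^2 \<le> x" using x by (simp add: power2_eq_square mult_left_le)
  then show ?thesis using exp_bound[OF x] by linarith
qed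

text \<open>The tolerance stays below 1/2 however large \<epsilon> is, so exp x \<le> 1 + 2 x
  applies, and 2 x < \<epsilon> gives the strict bounds. The case F = 0 is answered exactly.\<close>

lemma approximates_if_ln_close:
  assumes F: "0 \<le> F" and pos: "0 < W'" "0 < V" and eps: "0 < \<epsilon>"
    and d: "\<bar>ln V - ln W'\<bar> \<le> \<epsilon> / (1 + \<epsilon>) / 2"
  shows "approximates \<epsilon> (F * W') (F * V)"
proof (cases "F = 0")
  case True
  then show ?thesis by (simp add: approximates_def)
next
  case False
  then have F: "0 < F" using F by simp
  define x where "x = \<epsilon> / (1 + \<epsilon>) / 2"
  have x: "0 < x" "x \<le> 1" "2 * x < \<epsilon>" unfolding x_def using eps by (simp_all add: field_simps)
  have "V = W' * exp (ln V - ln W')" using pos by (simp add: exp_diff)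
  moreover have "exp (ln V - ln W') \<le> exp x" "exp (- x) \<le> exp (ln V - ln W')"
    using d unfolding x_def by (auto simp: abs_le_iff)
  moreover have "exp x < 1 + \<epsilon>" using exp_le_one_plus_double[of x] x by linarith
  moreover have "1 - \<epsilon> < exp (- x)" using exp_ge_add_one_self[of "- x"] x by linarith
  ultimately have "W' * (1 - \<epsilon>) < V" "V < W' * (1 + \<epsilon>)"
    using pos by (metis less_le_trans mult_strict_left_mono, metis le_less_trans mult_strict_left_mono)
  then show ?thesis unfolding approximates_def using F pos by (simp add: mult_ac)
qed

text \<open>The square root of c^2 + 4 is at least 3.23, and (2.57 + 3.23)/2 is exactly
  29/10.\<close>

lemma fib_exists:
  assumes "c \<ge> 2.57"
  shows "\<exists>al. fib al c"
proof -
  define s where "s = sqrt (c^2 + 4)"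
  have s2: "s * s = c * c + 4" unfolding s_def by (simp add: power2_eq_square)
  have "(2.57::real)^2 \<le> c^2" using assms by (intro power_mono) auto
  then have "(3.23::real)^2 \<le> c^2 + 4" by (simp add: power2_eq_square)
  then have s: "3.23 \<le> s" unfolding s_def by (intro real_le_rsqrt)
  define al where "al = (c + s) / 2"
  have al: "29/10 \<le> al" unfolding al_def using s assms by simp
  have "al * al = c * al + 1" unfolding al_def using s2 by (simp add: field_simps)
  then have "c = al - 1 / al" using al by (simp add: field_simps)
  then show ?thesis using al by (auto simp: fib_def)
qed

theorem theorem3p3:
  fixes lam c :: real
  assumes "lam > 0" and "c \<ge> 2.57"
  shows "has_FPTAS [c, lam] (fibonacci_range c (c / 2) (c + 2 / c)) {lam..}"
proof -
  obtain al where "fib al c" using fib_exists[OF assms(2)] by blast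
  then interpret fib al c .
  \<comment> \<open>The contraction rate is replaced by a rational above it and still below 1,
    because literals of the program are rational.\<close>
  have "1 - lam / (5 * (1 + lam)) < 1" using assms(1) by simp
  then obtain k where k: "1 - lam / (5 * (1 + lam)) < of_rat k" "of_rat k < (1::real)"
    using of_rat_dense by blast
  have "0 \<le> 1 - lam / (5 * (1 + lam))" using assms(1) by (simp add: field_simps)
  then have k0: "0 < (of_rat k :: real)" using k by linarith
  \<comment> \<open>The exponent that converts the branching factor 4 into a power of 1/k, and hence
    4^L into a power of \<open>x\<close>.\<close>
  obtain j where j: "(of_rat k :: real) ^ j < 1/4" using real_arch_pow_inv[of "1/4" "of_rat k"] k by auto
  have main: "\<exists>Z' t. runs (prog k) (map RealV [c, lam] @ [encode \<Omega>, RealV \<epsilon>]) (RealV Z') t \<and>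
      approximates \<epsilon> (partition_function \<Omega>) Z' \<and>
      real t \<le> (10000 * 28 ^ j) * (1 + real (inst_size \<Omega>) + 1 / \<epsilon>) ^ (2 + 2 * j)"
    if \<Omega>: "\<Omega> \<in> Holant (fibonacci_range c (c / 2) (c + 2 / c)) {lam..}" and eps: "0 < \<epsilon>" for \<Omega> \<epsilon>
  proof -
    let ?r = "vertex_ratio c \<Omega>" and ?E = "edge_list \<Omega>" and ?m = "nE \<Omega>"
    define F where "F = (\<Prod>v<nV \<Omega>. level (degree \<Omega> v) (fn \<Omega> v) 0)"
    have g: "admissible al (?r v)" for v by (rule admissible_vertex_ratio[OF \<Omega>])
    have rp: "0 < ?r v" for v by (rule admissible_pos[OF g])
    have E: "\<forall>e\<in>set ?E. edge_in (nV \<Omega>) e \<and> lam \<le> snd (snd e)"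
      using \<Omega> assms(1) by (force simp: edge_list_def edge_in_def edge_ok_def Holant_def wf_inst_def)
    then have E1: "\<forall>e\<in>set ?E. edge_in (nV \<Omega>) e" and E2: "\<forall>e\<in>set ?E. edge_ok e \<and> lam \<le> snd (snd e)"
      by (auto simp: edge_in_def)
    define x where "x = 28 * (1 + real ?m) * (1 + 1 / \<epsilon>)"
    have x1: "1 \<le> x"
    proof -
      have "28 * 1 * 1 \<le> x" unfolding x_def using eps by (intro mult_mono) auto
      then show ?thesis by simp
    qed
    obtain n where "(of_rat k :: real) ^ n < 1 / x" using real_arch_pow_inv[of "1 / x" "of_rat k"] k x1 by auto
    then have "x * of_rat k ^ n < 1" using x1 by (simp add: field_simps)
    with ev_depth[of k x n] k0 obtain L where
      L: "ev (prog k) [RealV x] (depth_body k) (RealV (real L)) (20 * (L + 1))"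
        "x * of_rat k ^ L < 1" "L = 0 \<or> 1 \<le> x * of_rat k ^ (L - 1)" by auto
    define V where "V = approx_Z c L ?r ?E"
    have ew: "0 < V" "\<bar>ln V - ln (normalized_Z c ?r ?E)\<bar> \<le> 14 * of_rat k ^ L * length ?E"
      using approx_Z_error[OF g E2 assms(1), of "of_rat k" L] k(1) by (auto simp: V_def)
    have "14 * of_rat k ^ L * length ?E \<le> \<epsilon> / (1 + \<epsilon>) / 2"
    proof -
      have "of_rat k ^ L \<le> 1 / x" using L(2) x1 by (simp add: field_simps)
      then have "14 * of_rat k ^ L * real (length ?E) \<le> 14 * (1 / x) * (1 + real ?m)"
        using k0 x1 by (intro mult_mono) (auto simp: edge_list_def)
      also have "\<dots> = 1 / (2 * (1 + 1 / \<epsilon>))"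
      proof -
        have cancel: "14 * (1 / (28 * a * b)) * a = 1 / (2 * b)" if "0 < a" for a b :: real using that by simp
        show ?thesis unfolding x_def by (rule cancel) simp
      qed
      also have "\<dots> = \<epsilon> / (1 + \<epsilon>) / 2" using eps by (simp add: field_simps)
      finally show ?thesis .
    qed
    then have close: "\<bar>ln V - ln (normalized_Z c ?r ?E)\<bar> \<le> \<epsilon> / (1 + \<epsilon>) / 2" using ew(2) by linarith
    have F0: "0 \<le> F" unfolding F_def using \<Omega>
      by (intro prod_nonneg) (auto simp: Holant_def fibonacci_range_def fibonacci_def)
    have Wp: "0 < normalized_Z c ?r ?E" by (rule normalized_Z_pos[OF c_pos rp]) (use E2 in auto)
    have app: "approximates \<epsilon> (partition_function \<Omega>) (F * V)"
      unfolding partition_function_eq[OF c_pos \<Omega>] F_def[symmetric]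
      by (rule approximates_if_ln_close[OF F0 Wp ew(1) eps close])
    have "ev (prog k) [RealV c, RealV lam, encode \<Omega>, RealV \<epsilon>] main_body (RealV (F * V))
        (2500 * (inst_size \<Omega> + 1) ^ 2 * 4 ^ L)"
      unfolding F_def V_def
      by (rule ev_main[OF c_pos rp E1 _ L(1)[unfolded x_def]]) (use eps in simp)
    then obtain t where t: "t \<le> 2500 * (inst_size \<Omega> + 1) ^ 2 * 4 ^ L"
      "eval (prog k) [RealV c, RealV lam, encode \<Omega>, RealV \<epsilon>] main_body (RealV (F * V)) t"
      by (auto simp: ev_def)
    have run: "runs (prog k) (map RealV [c, lam] @ [encode \<Omega>, RealV \<epsilon>]) (RealV (F * V)) t"
      using t(2) by (simp add: runs_def prog_def)
    \<comment> \<open>Minimality of L gives (1/k)^(L-1) \<le> x, and with 4 \<le> (1/k)^j this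
      yields 4^(L-1) \<le> x^j. The extra factor 4 pays for the last level.\<close>
    have L4: "4 ^ L \<le> 4 * x ^ j"
    proof (cases L)
      case 0
      then show ?thesis using one_le_power[OF x1, of j] by simp
    next
      case (Suc i)
      define q where "q = 1 / (of_rat k :: real)"
      have q: "q ^ i \<le> x" using L(3) Suc k0 by (simp add: q_def power_one_over divide_le_eq)
      have "4 \<le> q ^ j" unfolding q_def power_one_over using j k0 by (simp add: le_divide_eq)
      then have "4 ^ i \<le> (q ^ j) ^ i" by (intro power_mono) auto
      also have "\<dots> = (q ^ i) ^ j" by (simp only: power_mult[symmetric] mult.commute)
      also have "\<dots> \<le> x ^ j" using q k0 by (intro power_mono) (auto simp: q_def)
      finally show ?thesis using Suc by simp
    qed
    define B where "B = 1 + real (inst_size \<Omega>) + 1 / \<epsilon>"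
    have B1: "1 \<le> B" unfolding B_def using eps by simp
    \<comment> \<open>Both 1 + m and 1 + 1/\<epsilon> are at most B, so x^j contributes degree 2 j
      to the final exponent.\<close>
    have x28: "x \<le> 28 * B^2"
    proof -
      have "28 * (1 + real ?m) * (1 + 1 / \<epsilon>) \<le> 28 * B * B"
        unfolding B_def inst_size_def using eps by (intro mult_mono) auto
      then show ?thesis by (simp add: x_def power2_eq_square)
    qed
    have "real t \<le> real (2500 * (inst_size \<Omega> + 1) ^ 2 * 4 ^ L)" using t(1) by (simp only: of_nat_le_iff)
    also have "\<dots> = 2500 * (1 + real (inst_size \<Omega>)) ^ 2 * 4 ^ L" by (simp add: add.commute)
    also have "\<dots> \<le> 2500 * B ^ 2 * (4 * (28 * B^2) ^ j)"
    proof (intro mult_mono)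
      have "x ^ j \<le> (28 * B^2) ^ j" using x28 x1 by (intro power_mono) auto
      then show "4 ^ L \<le> 4 * (28 * B^2) ^ j" using L4 by linarith
    qed (use eps in \<open>auto simp: B_def intro!: power_mono\<close>)
    also have "\<dots> = (10000 * 28 ^ j) * B ^ (2 + 2 * j)"
      by (simp add: power_mult_distrib power_add power_mult power2_eq_square mult_ac)
    finally show ?thesis using run app unfolding B_def by blast
  qed
  show ?thesis unfolding has_FPTAS_def
    by (rule exI[of _ "prog k"], rule exI[of _ "10000 * 28 ^ j"], rule exI[of _ "2 + 2 * j"]) (use main in blast)
qed

end
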